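(* Let $n\geq 3$. If $u\in C^\infty(\mathbb{B}^n)$ is a nonnegative solution of the equation $$\begin{cases}-\Delta u=\dfrac{n-2}{4(n-1)}R\,u^{p} & \text{in }\mathbb{B}^n,\\[2mm] \dfrac{\partial u}{\partial\nu}+\lambda u=\dfrac{n-2}{2(n-1)}H\,u^{\frac{p+1}{2}} & \text{on }\mathbb{S}^{n-1},\end{cases}$$ where $R>0$, $H\geq 0$ are constants, $1<p\leq\frac{n+2}{n-2}$ and $0\leq\lambda\leq\frac{2}{p-1}$, then the following hold. (1) If $1<p\leq\frac{n+2}{n-2}$ and $\lambda=0$, then $u\equiv 0$. (2) If $p=\frac{n+2}{n-2}$ and $0<\lambda<\frac{2}{p-1}=\frac{n-2}{2}$, then $$u(x)=\left(\frac{n(n-1)}{R}\right)^{\frac{n-2}{4}}\left(\frac{1}{2\epsilon}|x|^2+\frac{\epsilon}{2}\right)^{-\frac{n-2}{2}},$$ where $$0<\epsilon=\sqrt{\frac{n(n-1)}{R}}\left(\frac{n-2}{2\lambda}\frac{H}{n-1}+\sqrt{\left(\frac{n-2}{2\lambda}\right)^2\left(\frac{H}{n-1}\right)^2+\frac{R}{n(n-1)}\left(\frac{n-2}{\lambda}-1\right)}\right).$$ (3) If $p=\frac{n+2}{n-2}$ and $\lambda=\frac{2}{p-1}=\frac{n-2}{2}$, then $$u(x)=\left(\frac{n(n-1)}{R}\right)^{\frac{n-2}{4}}\left(\frac{(1+\epsilon^2|a|^2)|x|^2+2(1+\epsilon^2)\langle x,a\rangle+(\epsilon^2+|a|^2)}{2\epsilon(1-|a|^2)}\right)^{-\frac{n-2}{2}},$$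 where $a\in\mathbb{B}^n$ and $$0<\epsilon=\sqrt{\frac{n(n-1)}{R}}\left(\frac{H}{n-1}+\sqrt{\left(\frac{H}{n-1}\right)^2+\frac{R}{n(n-1)}}\right).$$
   Context: $\mathbb{B}^n$ is the (open) unit ball of $\mathbb{R}^n$ with the Euclidean metric, $\mathbb{S}^{n-1}=\partial\mathbb{B}^n$ is the unit sphere, and $\nu$ is the outward unit normal on $\mathbb{S}^{n-1}$. Functions in $C^\infty(\mathbb{B}^n)$ are understood to be smooth up to the boundary. $\Delta$ is the Euclidean Laplacian $\sum_i\partial_i^2$, and $\langle\cdot,\cdot\rangle$, $|\cdot|$ are the Euclidean inner product and norm.
   Formalization: In (2) and (3) the conclusion is "u ≡ 0, or u is given by the formula", since u ≡ 0 is a nonnegative solution of the equation in both cases while the formulas are strictly positive; for u not identically 0 the claim is as stated. *)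

theory Defs
  imports "HOL-Analysis.Analysis"
begin

text \<open>
  Intended for open \<open>S\<close> in a finite-dimensional space, where it is the usual class \<open>C\<^sup>k\<close>:
  existence of Frechet derivatives at the lower orders is automatic there once the partial
  derivatives exist and are continuous.
\<close>
primrec Ck_on :: "nat \<Rightarrow> 'a::real_normed_vector set \<Rightarrow> ('a \<Rightarrow> 'b::real_normed_vector) \<Rightarrow> bool" where
  "Ck_on 0 S f \<longleftrightarrow> continuous_on S f"
| "Ck_on (Suc k) S f \<longleftrightarrow> (\<forall>x\<in>S. f differentiable (at x)) \<and>
     (\<forall>v. Ck_on k S (\<lambda>x. frechet_derivative f (at x) v))"

definition smooth_on :: "'a::real_normed_vector set \<Rightarrow> ('a \<Rightarrow> 'b::real_normed_vector) \<Rightarrow> bool" where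
  "smooth_on S f \<longleftrightarrow> (\<forall>k. Ck_on k S f)"

text \<open>
  Smoothness up to the boundary: restriction to the closed ball of a smooth function on an open
  neighbourhood. The values of \<open>u\<close> outside the closed ball play no role.
\<close>
definition smooth_up_to_boundary :: "(real ^ 'n \<Rightarrow> real) \<Rightarrow> bool" where
  "smooth_up_to_boundary u \<longleftrightarrow>
     (\<exists>U g. open U \<and> cball 0 1 \<subseteq> U \<and> smooth_on U g \<and> (\<forall>x\<in>cball 0 1. u x = g x))"

definition partial_derivative :: "'n \<Rightarrow> (real ^ 'n \<Rightarrow> real) \<Rightarrow> real ^ 'n \<Rightarrow> real" where
  "partial_derivative i f x = frechet_derivative f (at x) (axis i 1)"

definition laplacian :: "(real ^ 'n \<Rightarrow> real) \<Rightarrow> real ^ 'n \<Rightarrow> real" where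
  "laplacian f x = (\<Sum>i\<in>UNIV. partial_derivative i (partial_derivative i f) x)"

text \<open>
  The outward unit normal of the unit sphere at \<open>x\<close> is \<open>x\<close> itself. The derivative is taken from
  inside the ball, since \<open>u\<close> is only meaningful on the closed ball.
\<close>
definition normal_derivative :: "(real ^ 'n \<Rightarrow> real) \<Rightarrow> real ^ 'n \<Rightarrow> real" where
  "normal_derivative u x = vector_derivative (\<lambda>t. u (x + t *\<^sub>R x)) (at_left 0)"

end

theory Submission
  imports Defs
begin

text \<open>
  Write \<open>n\<close> for the dimension. The case \<open>\<lambda> = 0\<close> is the strong minimum principle: \<open>u\<close> is superharmonic, so
  by Hopf's lemma a boundary minimum of a nonconstant \<open>u\<close> would have negative outward derivative,
  whereas the boundary condition makes that derivative nonnegative. So \<open>u\<close> is constant, and the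
  equation in the interior leaves only \<open>0\<close>. The same principle shows that in the other cases \<open>u\<close> is
  identically zero or positive on the closed ball.

  For positive \<open>u\<close> and critical \<open>p\<close> put \<open>v = u\<^bsup>-2/(n-2)\<^esup>\<close>, so that \<open>v\<^bsup>-2\<^esup>|dx|\<^sup>2\<close> is the conformal metric of
  constant scalar curvature. With \<open>k = R/(n(n-1))\<close>, \<open>h = H/(n-1)\<close> and \<open>\<kappa> = 2\<lambda>/(n-2)\<close> the problem
  becomes \<open>\<Delta>v = nq\<close> for \<open>q = (|\<nabla>v|\<^sup>2 + k)/(2v)\<close>, with \<open>\<partial>\<^sub>\<nu>v = \<kappa>v - h\<close> on the sphere. Let
  \<open>E = D\<^sup>2v - qI\<close>, the trace-free Hessian. The formula for \<open>q\<close> gives \<open>\<nabla>q = E(\<nabla>v)/v\<close>, and with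
  \<open>\<Delta>v = nq\<close> this yields \<open>div(v\<^bsup>1-n\<^esup>E) = 0\<close>, the contracted Bianchi identity. Obata's argument tests this with a vector field.
  The field used here is
  \<open>X = f\<nabla>v + (h - \<kappa>v)x\<close> with \<open>f = 1 - \<kappa>(1 - |x|\<^sup>2)/2\<close>.
  Its first term has the derivative \<open>fD\<^sup>2v + \<kappa> x\<otimes>\<nabla>v\<close>, and the second term contributes
  \<open>-\<kappa> \<nabla>v\<otimes>x\<close> and a multiple of \<open>I\<close>; the two rank-one terms are antisymmetric together and vanish
  against \<open>E\<close>. Hence \<open>div(v\<^bsup>1-n\<^esup>E(X)) = v\<^bsup>1-n\<^esup> f |E|\<^sup>2 \<ge> 0\<close> (\<open>divergence_F\<close>). On the sphere \<open>f = 1\<close>, and by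
  the boundary condition \<open>X\<close> is the tangential gradient of \<open>v\<close>; differentiating that condition
  tangentially gives \<open>v\<^bsup>1-n\<^esup>E(X,\<nu>) = (\<kappa> - 1) v\<^bsup>1-n\<^esup> |X|\<^sup>2 \<le> 0\<close> (\<open>boundary_F\<close>). A field with nonnegative divergence
  that does not point outward on the sphere is divergence free (\<open>divergence_eq_0\<close>), so \<open>E = 0\<close>.

  Therefore \<open>v\<close> is a quadratic polynomial \<open>\<alpha>|x|\<^sup>2/2 + \<langle>b,x\<rangle> + c\<close>. The definition of \<open>q\<close> and the boundary
  condition reduce to \<open>2\<alpha>c = |b|\<^sup>2 + k\<close>, \<open>\<alpha> = \<kappa>(\<alpha>/2 + c) - h\<close> and \<open>(1 - \<kappa>)b = 0\<close>, and solving these equations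
  gives the two families of the theorem.
\<close>

section \<open>Calculus of smooth functions\<close>

lemma Ck_on_cong:
  assumes "open S" "\<And>x. x \<in> S \<Longrightarrow> f x = g x"
  shows "Ck_on k S f \<longleftrightarrow> Ck_on k S g"
  using assms(2)
proof (induction k arbitrary: f g)
  case 0
  then show ?case by (simp cong: continuous_on_cong)
next
  case (Suc k)
  have d: "(f has_derivative D) (at x) \<longleftrightarrow> (g has_derivative D) (at x)" if "x \<in> S" for x D
    using has_derivative_transform_within_open[OF _ \<open>open S\<close> that] Suc.prems by metis
  then have "f differentiable (at x) \<longleftrightarrow> g differentiable (at x)" if "x \<in> S" for x
    using that by (simp add: differentiable_def)
  moreover have fd: "frechet_derivative f (at x) v = frechet_derivative g (at x) v" if "x \<in> S" for x v
    using d[OF that] by (simp add: frechet_derivative_def)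
  ultimately show ?case
    using Suc.IH[of "\<lambda>x. frechet_derivative f (at x) _" "\<lambda>x. frechet_derivative g (at x) _", OF fd]
    by simp
qed

lemma Ck_on_Suc_imp: "Ck_on (Suc k) S f \<Longrightarrow> Ck_on k S f"
proof (induction k arbitrary: f)
  case 0
  then show ?case
    by (auto intro!: differentiable_imp_continuous_on simp: differentiable_on_def
        differentiable_at_withinI)
next
  case (Suc k)
  then show ?case by (metis Ck_on.simps(2))
qed

lemma Ck_on_const: "Ck_on k S (\<lambda>x. c)"
  by (induction k arbitrary: c) auto

lemma Ck_on_linear:
  assumes "bounded_linear f"
  shows "Ck_on k S f"
proof (cases k)
  case 0
  then show ?thesis by (simp add: assms linear_continuous_on)
next
  case (Suc j)
  have "(f has_derivative f) (at x)" for x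
    by (rule bounded_linear_imp_has_derivative[OF assms])
  then have "f differentiable (at x)" "frechet_derivative f (at x) = f" for x
    by (auto simp: differentiable_def frechet_derivative_at[symmetric])
  then show ?thesis using Suc by (simp add: Ck_on_const)
qed

lemma Ck_on_add:
  assumes "open S" "Ck_on k S f" "Ck_on k S g"
  shows "Ck_on k S (\<lambda>x. f x + g x)"
  using assms(2,3)
proof (induction k arbitrary: f g)
  case 0
  then show ?case by (auto intro: continuous_intros)
next
  case (Suc k)
  have hd: "((\<lambda>x. f x + g x) has_derivative
      (\<lambda>v. frechet_derivative f (at x) v + frechet_derivative g (at x) v)) (at x)" if "x \<in> S" for x
    using Suc.prems that by (intro has_derivative_add) (auto simp: frechet_derivative_works[symmetric])
  have "frechet_derivative (\<lambda>x. f x + g x) (at x) v =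
      frechet_derivative f (at x) v + frechet_derivative g (at x) v" if "x \<in> S" for x v
    using frechet_derivative_at[OF hd[OF that]] by metis
  note deriv = Ck_on_cong[OF \<open>open S\<close> this, of "\<lambda>x. x" _ "\<lambda>_. _", simplified]
  show ?case
    using Suc differentiableI[OF hd] deriv by auto
qed

lemma Ck_on_mult:
  fixes f g :: "'a::real_normed_vector \<Rightarrow> real"
  assumes "open S" "Ck_on k S f" "Ck_on k S g"
  shows "Ck_on k S (\<lambda>x. f x * g x)"
  using assms(2,3)
proof (induction k arbitrary: f g)
  case 0
  then show ?case by (auto intro: continuous_intros)
next
  case (Suc k)
  have hd: "((\<lambda>x. f x * g x) has_derivative
      (\<lambda>v. f x * frechet_derivative g (at x) v + frechet_derivative f (at x) v * g x)) (at x)"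
    if "x \<in> S" for x
    using Suc.prems that by (intro has_derivative_mult) (auto simp: frechet_derivative_works[symmetric])
  have "frechet_derivative (\<lambda>x. f x * g x) (at x) v =
      f x * frechet_derivative g (at x) v + frechet_derivative f (at x) v * g x" if "x \<in> S" for x v
    using frechet_derivative_at[OF hd[OF that]] by metis
  note deriv = Ck_on_cong[OF \<open>open S\<close> this, of "\<lambda>x. x" _ "\<lambda>_. _", simplified]
  show ?case
    using Suc differentiableI[OF hd] deriv Ck_on_Suc_imp[OF Suc.prems(1)] Ck_on_Suc_imp[OF Suc.prems(2)]
    by (auto intro!: Ck_on_add[OF \<open>open S\<close>])
qed

lemma Ck_on_powr:
  fixes f :: "'a::real_normed_vector \<Rightarrow> real"
  assumes "open S" "Ck_on k S f" "\<And>x. x \<in> S \<Longrightarrow> f x > 0"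
  shows "Ck_on k S (\<lambda>x. f x powr a)"
  using assms(2)
proof (induction k arbitrary: a)
  case 0
  then show ?case using assms(3)
    by (auto intro!: continuous_on_powr continuous_intros) force
next
  case (Suc k)
  have hd: "((\<lambda>x. f x powr a) has_derivative
      (\<lambda>v. a * (f x powr (a - 1) * frechet_derivative f (at x) v))) (at x)"
    if "x \<in> S" for x
  proof -
    have "(f has_derivative frechet_derivative f (at x)) (at x)"
      using Suc.prems that by (simp add: frechet_derivative_works[symmetric])
    then show ?thesis using assms(3)[OF that]
      by (auto intro!: derivative_eq_intros ext simp: powr_diff field_simps)
  qed
  have "frechet_derivative (\<lambda>x. f x powr a) (at x) v =
      a * (f x powr (a - 1) * frechet_derivative f (at x) v)" if "x \<in> S" for x v
    using frechet_derivative_at[OF hd[OF that]] by metis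
  note deriv = Ck_on_cong[OF \<open>open S\<close> this, of "\<lambda>x. x" _ "\<lambda>_. _", simplified]
  show ?case
    using Suc differentiableI[OF hd] deriv Ck_on_Suc_imp[OF Suc.prems]
    by (auto intro!: Ck_on_mult[OF \<open>open S\<close>] Ck_on_const)
qed

lemma Ck_on_subset: "Ck_on k S f \<Longrightarrow> T \<subseteq> S \<Longrightarrow> Ck_on k T f"
  by (induction k arbitrary: f) (auto intro: continuous_on_subset)

lemma smooth_on_subset: "smooth_on S f \<Longrightarrow> T \<subseteq> S \<Longrightarrow> smooth_on T f"
  by (auto simp: smooth_on_def intro: Ck_on_subset)

lemma smooth_on_const: "smooth_on S (\<lambda>x. c)"
  by (simp add: smooth_on_def Ck_on_const)

lemma smooth_on_component: "smooth_on S (\<lambda>x::real^'n. x $ i)"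
  by (simp add: smooth_on_def Ck_on_linear bounded_linear_vec_nth)

lemma smooth_on_add:
  "open S \<Longrightarrow> smooth_on S f \<Longrightarrow> smooth_on S g \<Longrightarrow> smooth_on S (\<lambda>x. f x + g x)"
  by (simp add: smooth_on_def Ck_on_add)

lemma smooth_on_mult:
  fixes f g :: "'a::real_normed_vector \<Rightarrow> real"
  shows "open S \<Longrightarrow> smooth_on S f \<Longrightarrow> smooth_on S g \<Longrightarrow> smooth_on S (\<lambda>x. f x * g x)"
  by (simp add: smooth_on_def Ck_on_mult)

lemma smooth_on_diff:
  fixes f g :: "'a::real_normed_vector \<Rightarrow> real"
  assumes "open S" "smooth_on S f" "smooth_on S g"
  shows "smooth_on S (\<lambda>x. f x - g x)"
  using smooth_on_add[OF assms(1,2) smooth_on_mult[OF assms(1) smooth_on_const[of S "-1"] assms(3)]]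
  by simp

lemma smooth_on_sum:
  assumes "open S" "\<And>i. i \<in> I \<Longrightarrow> smooth_on S (f i)"
  shows "smooth_on S (\<lambda>x. \<Sum>i\<in>I. f i x)"
  using assms(2)
  by (induction I rule: infinite_finite_induct)
     (auto intro: smooth_on_add[OF assms(1)] smooth_on_const)

lemma smooth_on_powr:
  fixes f :: "'a::real_normed_vector \<Rightarrow> real"
  shows "open S \<Longrightarrow> smooth_on S f \<Longrightarrow> (\<And>x. x \<in> S \<Longrightarrow> f x > 0) \<Longrightarrow> smooth_on S (\<lambda>x. f x powr a)"
  by (simp add: smooth_on_def Ck_on_powr)

lemma smooth_on_differentiable: "smooth_on S f \<Longrightarrow> x \<in> S \<Longrightarrow> f differentiable (at x)"
  unfolding smooth_on_def by (metis Ck_on.simps(2))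

lemma smooth_on_continuous: "smooth_on S f \<Longrightarrow> continuous_on S f"
  unfolding smooth_on_def by (metis Ck_on.simps(1))

lemma smooth_on_partial: "smooth_on S f \<Longrightarrow> smooth_on S (partial_derivative i f)"
  unfolding smooth_on_def partial_derivative_def[abs_def] by (metis Ck_on.simps(2))

lemma partial_derivative_eq:
  "(f has_derivative f') (at x) \<Longrightarrow> partial_derivative i f x = f' (axis i 1)"
  unfolding partial_derivative_def by (metis frechet_derivative_at)

lemma has_derivative_partial:
  fixes f :: "real^'n \<Rightarrow> real"
  assumes "f differentiable (at x)"
  shows "(f has_derivative (\<lambda>h. \<Sum>i\<in>UNIV. h $ i * partial_derivative i f x)) (at x)"
proof -
  let ?D = "frechet_derivative f (at x)"
  have D: "(f has_derivative ?D) (at x)" using assms by (simp add: frechet_derivative_works)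
  have "linear ?D" using assms by (rule linear_frechet_derivative)
  have "?D h = (\<Sum>i\<in>UNIV. h $ i * partial_derivative i f x)" for h
  proof -
    have "?D h = ?D (\<Sum>i\<in>UNIV. h $ i *\<^sub>R axis i 1)"
      using basis_expansion[of h] by (simp add: scalar_mult_eq_scaleR)
    also have "\<dots> = (\<Sum>i\<in>UNIV. h $ i * ?D (axis i 1))"
      using \<open>linear ?D\<close> by (simp add: linear_sum linear_cmul)
    finally show ?thesis by (simp add: partial_derivative_def)
  qed
  then have "?D = (\<lambda>h. \<Sum>i\<in>UNIV. h $ i * partial_derivative i f x)" by (rule ext)
  with D show ?thesis by simp
qed

lemma frechet_derivative_eq_sum:
  fixes f :: "real^'n \<Rightarrow> real"
  assumes "f differentiable (at x)"
  shows "frechet_derivative f (at x) h = (\<Sum>i\<in>UNIV. h $ i * partial_derivative i f x)"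
  by (rule fun_cong[OF frechet_derivative_at[OF has_derivative_partial[OF assms], symmetric]])

lemma partial_derivative_cong:
  assumes "open S" "x \<in> S" "\<And>y. y \<in> S \<Longrightarrow> f y = g y"
  shows "partial_derivative i f x = partial_derivative i g x"
proof -
  have "(f has_derivative D) (at x) \<longleftrightarrow> (g has_derivative D) (at x)" for D
    using has_derivative_transform_within_open[OF _ assms(1,2)] assms(3) by metis
  then show ?thesis by (simp add: partial_derivative_def frechet_derivative_def)
qed

lemma laplacian_cong:
  assumes "open S" "x \<in> S" "\<And>y. y \<in> S \<Longrightarrow> f y = g y"
  shows "laplacian f x = laplacian g x"
  unfolding laplacian_def
  by (intro sum.cong refl partial_derivative_cong[OF assms(1,2)] partial_derivative_cong[OF assms(1) _ assms(3)])

lemma partial_derivative_const [simp]: "partial_derivative i (\<lambda>x. c) x = 0"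
  by (simp add: partial_derivative_def)

lemma partial_derivative_component:
  "partial_derivative i (\<lambda>x. x $ j) x = (if i = j then 1 else 0)"
  using partial_derivative_eq[OF bounded_linear_imp_has_derivative[OF bounded_linear_vec_nth[of j]], of i x]
  by (simp add: axis_def)

context
  fixes f g :: "real^'n \<Rightarrow> real" and x
  assumes fg: "f differentiable (at x)" "g differentiable (at x)"
begin

lemma partial_derivative_add:
  "partial_derivative i (\<lambda>x. f x + g x) x = partial_derivative i f x + partial_derivative i g x"
  using partial_derivative_eq[OF has_derivative_add[OF fg[THEN frechet_derivative_works[THEN iffD1]]]]
  by (simp add: partial_derivative_def)

lemma partial_derivative_diff:
  "partial_derivative i (\<lambda>x. f x - g x) x = partial_derivative i f x - partial_derivative i g x"
  using partial_derivative_eq[OF has_derivative_diff[OF fg[THEN frechet_derivative_works[THEN iffD1]]]]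
  by (simp add: partial_derivative_def)

lemma partial_derivative_mult:
  "partial_derivative i (\<lambda>x. f x * g x) x =
     f x * partial_derivative i g x + partial_derivative i f x * g x"
  using partial_derivative_eq[OF has_derivative_mult[OF fg[THEN frechet_derivative_works[THEN iffD1]]]]
  by (simp add: partial_derivative_def)

end

lemma partial_derivative_powr:
  fixes f :: "real^'n \<Rightarrow> real"
  assumes "f differentiable (at x)" "f x > 0"
  shows "partial_derivative i (\<lambda>x. f x powr a) x = a * f x powr (a - 1) * partial_derivative i f x"
proof -
  have "((\<lambda>x. f x powr a) has_derivative
      (\<lambda>v. a * f x powr (a - 1) * frechet_derivative f (at x) v)) (at x)"
    using assms(1)[THEN frechet_derivative_works[THEN iffD1]] assms(2)
    by (auto intro!: derivative_eq_intros ext simp: powr_diff field_simps)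
  from partial_derivative_eq[OF this] show ?thesis by (simp add: partial_derivative_def)
qed

lemma partial_derivative_sum:
  fixes f :: "'a \<Rightarrow> real^'n \<Rightarrow> real"
  assumes "\<And>j. j \<in> I \<Longrightarrow> f j differentiable (at x)"
  shows "partial_derivative i (\<lambda>x. \<Sum>j\<in>I. f j x) x = (\<Sum>j\<in>I. partial_derivative i (f j) x)"
proof -
  have "((\<lambda>x. \<Sum>j\<in>I. f j x) has_derivative (\<lambda>h. \<Sum>j\<in>I. frechet_derivative (f j) (at x) h)) (at x)"
    using assms by (intro has_derivative_sum) (simp add: frechet_derivative_works[symmetric])
  from partial_derivative_eq[OF this] show ?thesis by (simp add: partial_derivative_def)
qed

lemma partial_derivative_line:
  fixes f :: "real^'n \<Rightarrow> real"
  assumes "f differentiable (at (x + t *\<^sub>R axis i 1))"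
  shows "((\<lambda>s. f (x + s *\<^sub>R axis i 1)) has_real_derivative
           partial_derivative i f (x + t *\<^sub>R axis i 1)) (at t)"
proof -
  have 1: "((\<lambda>s. x + s *\<^sub>R axis i 1) has_derivative (\<lambda>s. s *\<^sub>R axis i (1::real))) (at t)"
    by (auto intro!: derivative_eq_intros)
  have "linear (frechet_derivative f (at (x + t *\<^sub>R axis i 1)))"
    using assms by (rule linear_frechet_derivative)
  then show ?thesis
    using diff_chain_at[OF 1 assms[THEN frechet_derivative_works[THEN iffD1]]]
    by (simp add: has_field_derivative_def o_def partial_derivative_def linear_cmul mult_commute_abs)
qed

text \<open>The mean value theorem, applied in direction \<open>i\<close> to a difference in direction \<open>j\<close> and then in
  direction \<open>j\<close>. The left-hand side is symmetric in \<open>i\<close> and \<open>j\<close>; this gives the symmetry of second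
  derivatives below, on letting \<open>s\<close> tend to \<open>0\<close>.\<close>
lemma second_difference_mvt:
  fixes f :: "real^'n \<Rightarrow> real"
  assumes f: "smooth_on S f" and s: "s > 0"
    and ball: "\<And>a b. 0 \<le> a \<Longrightarrow> a \<le> s \<Longrightarrow> 0 \<le> b \<Longrightarrow> b \<le> s \<Longrightarrow> x + a *\<^sub>R axis i 1 + b *\<^sub>R axis j 1 \<in> S"
  obtains a b where "0 \<le> a" "a \<le> s" "0 \<le> b" "b \<le> s"
    "f (x + s *\<^sub>R axis i 1 + s *\<^sub>R axis j 1) - f (x + s *\<^sub>R axis i 1) - f (x + s *\<^sub>R axis j 1) + f x
      = s * s * partial_derivative j (partial_derivative i f) (x + a *\<^sub>R axis i 1 + b *\<^sub>R axis j 1)"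
proof -
  let ?i = "axis i (1::real)" and ?j = "axis j (1::real)"
  define \<phi> where "\<phi> a = f (x + s *\<^sub>R ?j + a *\<^sub>R ?i) - f (x + a *\<^sub>R ?i)" for a
  have S: "x + s *\<^sub>R ?j + a *\<^sub>R ?i \<in> S" "x + a *\<^sub>R ?i \<in> S" if "0 \<le> a" "a \<le> s" for a
    using ball[of a s] ball[of a 0] that s by (simp_all add: algebra_simps)
  have "\<exists>z>0. z < s \<and> \<phi> s - \<phi> 0 = (s - 0) *
     (partial_derivative i f (x + s *\<^sub>R ?j + z *\<^sub>R ?i) - partial_derivative i f (x + z *\<^sub>R ?i))"
    unfolding \<phi>_def using s S f
    by (intro MVT2) (auto intro!: DERIV_diff partial_derivative_line smooth_on_differentiable[OF f])
  then obtain a where a: "0 < a" "a < s" "\<phi> s - \<phi> 0 = s *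
     (partial_derivative i f (x + s *\<^sub>R ?j + a *\<^sub>R ?i) - partial_derivative i f (x + a *\<^sub>R ?i))"
    by auto
  define \<psi> where "\<psi> b = partial_derivative i f (x + a *\<^sub>R ?i + b *\<^sub>R ?j)" for b
  have "\<exists>z>0. z < s \<and> \<psi> s - \<psi> 0 = (s - 0) *
     partial_derivative j (partial_derivative i f) (x + a *\<^sub>R ?i + z *\<^sub>R ?j)"
    unfolding \<psi>_def using s a f
    by (intro MVT2) (auto intro!: partial_derivative_line smooth_on_differentiable[OF smooth_on_partial[OF f]] ball)
  then obtain b where b: "0 < b" "b < s" "\<psi> s - \<psi> 0 = s *
     partial_derivative j (partial_derivative i f) (x + a *\<^sub>R ?i + b *\<^sub>R ?j)"
    by auto
  show ?thesis
    using a b by (intro that[of a b]) (auto simp: \<phi>_def \<psi>_def algebra_simps)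
qed

lemma partial_derivatives_commute:
  fixes f :: "real^'n \<Rightarrow> real"
  assumes "open S" "smooth_on S f" "x \<in> S"
  shows "partial_derivative i (partial_derivative j f) x = partial_derivative j (partial_derivative i f) x"
    (is "?A x = ?B x")
proof (rule ccontr)
  assume "?A x \<noteq> ?B x"
  define e where "e = \<bar>?A x - ?B x\<bar> / 2"
  have e: "e > 0" using \<open>?A x \<noteq> ?B x\<close> by (simp add: e_def)
  have "continuous_on S ?A" "continuous_on S ?B"
    using assms(2) by (auto intro!: smooth_on_continuous smooth_on_partial)
  then have "isCont ?A x" "isCont ?B x"
    using assms(1,3) by (simp_all add: continuous_on_eq_continuous_at)
  then obtain d1 d2 where d: "d1 > 0" "d2 > 0"
    "\<And>y. dist y x < d1 \<Longrightarrow> dist (?A y) (?A x) < e" "\<And>y. dist y x < d2 \<Longrightarrow> dist (?B y) (?B x) < e"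
    using e unfolding continuous_at_eps_delta by metis
  obtain d3 where d3: "d3 > 0" "ball x d3 \<subseteq> S" using assms(1,3) open_contains_ball by metis
  define s where "s = Min {d1,d2,d3} / 3"
  have s: "s > 0" "2 * s < d1" "2 * s < d2" "2 * s < d3"
    using d(1,2) d3(1) by (auto simp: s_def)
  have near: "dist (x + a *\<^sub>R axis k 1 + b *\<^sub>R axis l 1) x \<le> 2 * s"
    if "0 \<le> a" "a \<le> s" "0 \<le> b" "b \<le> s" for a b k l
  proof -
    have "norm (a *\<^sub>R axis k (1::real) + b *\<^sub>R axis l 1) \<le> a + b"
      using norm_triangle_ineq[of "a *\<^sub>R axis k (1::real)" "b *\<^sub>R axis l (1::real)"] that
      by (simp add: norm_axis_1)
    then show ?thesis using that by (simp add: dist_norm add.assoc)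
  qed
  have inS: "x + a *\<^sub>R axis k 1 + b *\<^sub>R axis l 1 \<in> S"
    if "0 \<le> a" "a \<le> s" "0 \<le> b" "b \<le> s" for a b k l
    using near[OF that, of k l] s(4) d3(2) by (auto simp: subset_eq mem_ball dist_commute)
  obtain a b where ab: "0 \<le> a" "a \<le> s" "0 \<le> b" "b \<le> s"
    "f (x + s *\<^sub>R axis i 1 + s *\<^sub>R axis j 1) - f (x + s *\<^sub>R axis i 1) - f (x + s *\<^sub>R axis j 1) + f x
      = s * s * ?B (x + a *\<^sub>R axis i 1 + b *\<^sub>R axis j 1)"
    using second_difference_mvt[OF assms(2) s(1) inS, of i j] by blast
  obtain a' b' where ab': "0 \<le> a'" "a' \<le> s" "0 \<le> b'" "b' \<le> s"
    "f (x + s *\<^sub>R axis j 1 + s *\<^sub>R axis i 1) - f (x + s *\<^sub>R axis j 1) - f (x + s *\<^sub>R axis i 1) + f x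
      = s * s * ?A (x + a' *\<^sub>R axis j 1 + b' *\<^sub>R axis i 1)"
    using second_difference_mvt[OF assms(2) s(1) inS, of j i] by blast
  have "s * s * ?B (x + a *\<^sub>R axis i 1 + b *\<^sub>R axis j 1) = s * s * ?A (x + a' *\<^sub>R axis j 1 + b' *\<^sub>R axis i 1)"
    using ab(5) ab'(5) by (simp add: algebra_simps)
  then have "?B (x + a *\<^sub>R axis i 1 + b *\<^sub>R axis j 1) = ?A (x + a' *\<^sub>R axis j 1 + b' *\<^sub>R axis i 1)"
    using s(1) by simp
  moreover have "dist (?B (x + a *\<^sub>R axis i 1 + b *\<^sub>R axis j 1)) (?B x) < e"
    using near[OF ab(1-4), of i j] s by (intro d) auto
  moreover have "dist (?A (x + a' *\<^sub>R axis j 1 + b' *\<^sub>R axis i 1)) (?A x) < e"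
    using near[OF ab'(1-4), of j i] s by (intro d) auto
  ultimately show False
    unfolding e_def dist_real_def by (simp add: abs_if split: if_splits)
qed

section \<open>The strong minimum principle with Hopf's boundary point lemma\<close>

text \<open>At an interior minimum the first derivative along each coordinate line vanishes. If the second one
  were negative, the function would decrease just after the minimum.\<close>
lemma second_partial_nonneg_at_min:
  fixes w :: "real^'n \<Rightarrow> real"
  assumes "open S" "smooth_on S w" "z \<in> S" and min: "\<And>x. x \<in> S \<Longrightarrow> w z \<le> w x"
  shows "partial_derivative i (partial_derivative i w) z \<ge> 0"
proof (rule ccontr)
  let ?e = "axis i (1::real)"
  assume neg: "\<not> ?thesis"
  obtain d where d: "d > 0" "ball z d \<subseteq> S" using assms(1,3) open_contains_ball by metis
  have inS: "z + t *\<^sub>R ?e \<in> S" if "\<bar>t\<bar> < d" for t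
    using d(2) that by (auto simp: subset_eq dist_norm norm_axis_1)
  have D1: "((\<lambda>s. w (z + s *\<^sub>R ?e)) has_real_derivative partial_derivative i w (z + t *\<^sub>R ?e)) (at t)"
    if "\<bar>t\<bar> < d" for t
    by (intro partial_derivative_line smooth_on_differentiable[OF assms(2)] inS that)
  have D2: "((\<lambda>s. partial_derivative i w (z + s *\<^sub>R ?e)) has_real_derivative
      partial_derivative i (partial_derivative i w) (z + 0 *\<^sub>R ?e)) (at 0)"
    using d by (intro partial_derivative_line smooth_on_differentiable[OF smooth_on_partial[OF assms(2)]] inS) auto
  have zero: "partial_derivative i w (z + 0 *\<^sub>R ?e) = 0"
    using d min inS by (intro DERIV_local_min[OF D1 d(1)]) auto
  obtain d' where d': "d' > 0" "\<And>h. 0 < h \<Longrightarrow> h < d' \<Longrightarrow> partial_derivative i w (z + h *\<^sub>R ?e) < 0"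
    using DERIV_neg_dec_right[OF D2] neg zero by auto
  define t where "t = min d d' / 2"
  have t: "0 < t" "t < d" "t < d'" using d d' by (auto simp: t_def)
  have "\<exists>s>0. s < t \<and> w (z + t *\<^sub>R ?e) - w (z + 0 *\<^sub>R ?e) = (t - 0) * partial_derivative i w (z + s *\<^sub>R ?e)"
    using t by (intro MVT2 D1) auto
  then obtain s where s: "0 < s" "s < t" "w (z + t *\<^sub>R ?e) - w z = t * partial_derivative i w (z + s *\<^sub>R ?e)"
    by auto
  have "w (z + t *\<^sub>R ?e) - w z < 0"
    using s t d'(2)[of s] by (simp add: mult_pos_neg)
  then show False using min[OF inS[of t]] t by auto
qed

definition sq_dist :: "real^'n \<Rightarrow> real^'n \<Rightarrow> real" where
  "sq_dist y x = (\<Sum>j\<in>UNIV. (x $ j - y $ j) * (x $ j - y $ j))"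

lemma sq_dist_eq: "sq_dist y x = (dist y x)\<^sup>2"
  by (simp add: sq_dist_def dist_norm norm_minus_commute power2_norm_eq_inner inner_vec_def)

lemma smooth_on_sq_dist: "open S \<Longrightarrow> smooth_on S (sq_dist y)"
  unfolding sq_dist_def
  by (intro smooth_on_sum smooth_on_mult smooth_on_diff smooth_on_component smooth_on_const)

lemma partial_derivative_component_diff:
  fixes x :: "real^'n"
  shows "partial_derivative i (\<lambda>x. x $ j - c) x = (if i = j then 1 else 0)"
proof -
  have "(\<lambda>x::real^'n. x $ j) differentiable (at x)"
    using smooth_on_differentiable[OF smooth_on_component, of x UNIV] by simp
  from partial_derivative_diff[OF this differentiable_const, of i c] show ?thesis
    by (simp add: partial_derivative_component)
qed

lemma partial_derivative_sq_dist:
  fixes x :: "real^'n"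
  shows "partial_derivative i (sq_dist y) x = 2 * (x $ i - y $ i)"
proof -
  have d: "(\<lambda>x::real^'n. x $ j - y $ j) differentiable (at x)" for j
    by (rule smooth_on_differentiable[OF smooth_on_diff[OF open_UNIV smooth_on_component smooth_on_const]]) simp
  have "partial_derivative i (sq_dist y) x
      = (\<Sum>j\<in>UNIV. partial_derivative i (\<lambda>x. (x $ j - y $ j) * (x $ j - y $ j)) x)"
    unfolding sq_dist_def by (intro partial_derivative_sum differentiable_mult d)
  also have "\<dots> = (\<Sum>j\<in>UNIV. if j = i then 2 * (x $ j - y $ j) else 0)"
    by (intro sum.cong refl) (simp add: partial_derivative_mult[OF d d] partial_derivative_component_diff)
  finally show ?thesis by simp
qed

lemma smooth_on_sq_dist_powr: "smooth_on (- {y}) (\<lambda>x. sq_dist y x powr a)"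
  by (intro smooth_on_powr smooth_on_sq_dist) (auto simp: sq_dist_eq)

lemma partial_derivative_sq_dist_powr:
  fixes x :: "real^'n"
  assumes "x \<noteq> y"
  shows "partial_derivative i (\<lambda>x. sq_dist y x powr a) x
          = 2 * a * (sq_dist y x powr (a - 1) * (x $ i - y $ i))"
proof -
  have "sq_dist y x > 0" using assms by (simp add: sq_dist_eq)
  moreover have "sq_dist y differentiable (at x)"
    by (rule smooth_on_differentiable[OF smooth_on_sq_dist[OF open_UNIV]]) simp
  ultimately show ?thesis
    by (simp add: partial_derivative_powr partial_derivative_sq_dist)
qed

text \<open>This is the source of the barrier in Hopf's lemma: with exponent \<open>a = -n\<close> the right-hand side is
  positive, so \<open>|x - y|\<^bsup>-2n\<^esup>\<close> is strictly subharmonic away from \<open>y\<close>.\<close>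
lemma laplacian_sq_dist_powr:
  fixes x y :: "real^'n"
  assumes "x \<noteq> y"
  shows "laplacian (\<lambda>x. sq_dist y x powr a) x
          = 2 * a * (2 * (a - 1) + real CARD('n)) * sq_dist y x powr (a - 1)"
proof -
  have pos: "sq_dist y x > 0" using assms by (simp add: sq_dist_eq)
  have "partial_derivative i (partial_derivative i (\<lambda>x. sq_dist y x powr a)) x =
    2 * a * (2 * (a - 1) * sq_dist y x powr (a - 2) * ((x $ i - y $ i) * (x $ i - y $ i))
       + sq_dist y x powr (a - 1))" for i
  proof -
    have p: "(\<lambda>x. sq_dist y x powr (a - 1)) differentiable (at x)"
      using assms by (intro smooth_on_differentiable[OF smooth_on_sq_dist_powr[of y]]) simp
    have l: "(\<lambda>x. x $ i - y $ i) differentiable (at x)"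
      by (rule smooth_on_differentiable[OF smooth_on_diff[OF open_UNIV smooth_on_component smooth_on_const]]) simp
    have "partial_derivative i (partial_derivative i (\<lambda>x. sq_dist y x powr a)) x =
        partial_derivative i (\<lambda>x. (2 * a) * (sq_dist y x powr (a - 1) * (x $ i - y $ i))) x"
      using assms by (intro partial_derivative_cong[of "- {y}"] partial_derivative_sq_dist_powr) auto
    also have "\<dots> = 2 * a * (sq_dist y x powr (a - 1) + 2 * (a - 1) *
        (sq_dist y x powr (a - 1 - 1) * (x $ i - y $ i)) * (x $ i - y $ i))"
      by (subst partial_derivative_mult)
        (auto simp: partial_derivative_mult[OF p l] partial_derivative_component_diff
          partial_derivative_sq_dist_powr[OF assms] intro: differentiable_mult p l)
    finally show ?thesis by (simp add: algebra_simps)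
  qed
  then have "laplacian (\<lambda>x. sq_dist y x powr a) x =
     (\<Sum>i\<in>UNIV. 2 * a * (2 * (a - 1) * sq_dist y x powr (a - 2) * ((x $ i - y $ i) * (x $ i - y $ i))
       + sq_dist y x powr (a - 1)))"
    by (simp add: laplacian_def)
  also have "\<dots> = 2 * a * (2 * (a - 1) * (sq_dist y x powr (a - 2) * sq_dist y x)
       + real CARD('n) * sq_dist y x powr (a - 1))"
    by (simp add: sum_distrib_left[symmetric] sum.distrib sq_dist_def)
  also have "sq_dist y x powr (a - 2) * sq_dist y x = sq_dist y x powr (a - 1)"
    using pos powr_add[of "sq_dist y x" "a - 2" 1] by simp
  finally show ?thesis by (simp add: algebra_simps)
qed

lemma laplacian_add:
  assumes "open S" "smooth_on S f" "smooth_on S g" "x \<in> S"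
  shows "laplacian (\<lambda>x. f x + g x) x = laplacian f x + laplacian g x"
proof -
  have "partial_derivative i (partial_derivative i (\<lambda>x. f x + g x)) x =
     partial_derivative i (\<lambda>x. partial_derivative i f x + partial_derivative i g x) x" for i
    using assms by (intro partial_derivative_cong[of S] partial_derivative_add)
      (auto intro: smooth_on_differentiable)
  also have "\<dots> i = partial_derivative i (partial_derivative i f) x + partial_derivative i (partial_derivative i g) x" for i
    using assms by (intro partial_derivative_add) (auto intro!: smooth_on_differentiable smooth_on_partial)
  finally show ?thesis by (simp add: laplacian_def sum.distrib)
qed

lemma laplacian_cmult:
  assumes "open S" "smooth_on S f" "x \<in> S"
  shows "laplacian (\<lambda>x. c * f x) x = c * laplacian f x"
proof -
  have "partial_derivative i (partial_derivative i (\<lambda>x. c * f x)) x =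
     partial_derivative i (\<lambda>x. c * partial_derivative i f x) x" for i
    using assms by (intro partial_derivative_cong[of S])
      (auto simp: partial_derivative_mult[OF differentiable_const] dest: smooth_on_differentiable)
  also have "\<dots> i = c * partial_derivative i (partial_derivative i f) x" for i
    using smooth_on_differentiable[OF smooth_on_partial[OF assms(2)] assms(3), of i]
    by (simp add: partial_derivative_mult[OF differentiable_const])
  finally show ?thesis by (simp add: laplacian_def sum_distrib_left)
qed

lemma laplacian_const [simp]: "laplacian (\<lambda>x. c) x = 0"
  by (simp add: laplacian_def partial_derivative_def[abs_def])

text \<open>On the annulus \<open>r/2 \<le> |x - y| \<le> r\<close> subtract from \<open>g - m\<close> a small multiple of the barrier
  \<open>|x - y|\<^bsup>-2n\<^esup> - r\<^bsup>-2n\<^esup>\<close>. The difference is nonnegative on both boundary spheres and strictly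
  superharmonic between them, hence nonnegative. It vanishes at \<open>x0\<close>, so its derivative towards the
  centre is nonnegative, and the barrier has positive derivative in that direction.\<close>
lemma hopf_boundary_point:
  fixes g :: "real^'n \<Rightarrow> real"
  assumes r: "r > 0" and U: "open U" "smooth_on U g" "cball y r \<subseteq> U"
    and lap: "\<And>x. x \<in> ball y r \<Longrightarrow> laplacian g x \<le> 0"
    and above: "\<And>x. x \<in> ball y r \<Longrightarrow> g x > m"
    and x0: "dist y x0 = r" "g x0 = m"
  shows "frechet_derivative g (at x0) (x0 - y) < 0"
proof -
  let ?N = "real CARD('n)"
  define b where "b x = sq_dist y x powr (- ?N)" for x
  define A where "A = cball y r - ball y (r / 2)"
  have gcont: "continuous_on (cball y r) g"
    using U smooth_on_continuous continuous_on_subset by blast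
  have geq: "g x \<ge> m" if "x \<in> cball y r" for x
    using continuous_ge_on_closure[of "ball y r" g x m] gcont above that r
    by (auto simp: closure_ball less_imp_le)
  have "sphere y (r/2) \<noteq> {}" using r by simp
  moreover have "sphere y (r/2) \<subseteq> cball y r" using r by (auto simp: sphere_def)
  ultimately have "\<exists>z\<in>sphere y (r/2). \<forall>x\<in>sphere y (r/2). g z \<le> g x"
    using r gcont by (intro continuous_attains_inf compact_sphere continuous_on_subset[OF gcont])
  then obtain z0 where z0: "dist y z0 = r/2" "\<And>x. dist y x = r/2 \<Longrightarrow> g z0 \<le> g x" by auto
  \<comment> \<open>The largest multiple of the barrier that stays below \<open>g - m\<close> on the inner sphere.\<close>
  define e where "e = (g z0 - m) * ((r/2)\<^sup>2) powr ?N"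
  have e: "e > 0" using above[of z0] z0 r by (simp add: e_def)
  define w where "w x = g x + (- e) * b x + (e * (r\<^sup>2) powr (- ?N) - m)" for x
  define S where "S = U - {y}"
  have S: "open S" using U by (auto simp: S_def)
  have sm: "smooth_on S g" "smooth_on S b"
    unfolding b_def using U smooth_on_sq_dist_powr
    by (auto simp: S_def intro: smooth_on_subset)
  have smw: "smooth_on S w" unfolding w_def
    using S sm by (intro smooth_on_add smooth_on_mult smooth_on_const)
  have AS: "A \<subseteq> S" using U r by (auto simp: A_def S_def)
  have w_lap: "laplacian w x < 0" if "x \<in> ball y r" "x \<noteq> y" for x
  proof -
    have xS: "x \<in> S" using that U by (auto simp: S_def)
    have sb: "smooth_on S (\<lambda>x. (- e) * b x)"
      using S sm by (intro smooth_on_mult smooth_on_const)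
    have "laplacian w x = laplacian (\<lambda>x. g x + (- e) * b x) x"
      unfolding w_def laplacian_add[OF S smooth_on_add[OF S sm(1) sb] smooth_on_const xS] by simp
    also have "\<dots> = laplacian g x + laplacian (\<lambda>x. (- e) * b x) x"
      by (rule laplacian_add[OF S sm(1) sb xS])
    finally have "laplacian w x = laplacian g x + laplacian (\<lambda>x. (- e) * b x) x" .
    then have "laplacian w x = laplacian g x + (- e) * laplacian b x"
      using laplacian_cmult[OF S sm(2) xS] by metis
    moreover have "laplacian b x = 2 * ?N * (?N + 2) * sq_dist y x powr (- ?N - 1)"
      unfolding b_def[abs_def] by (simp add: laplacian_sq_dist_powr[OF that(2)] algebra_simps)
    then have "laplacian b x > 0" using that(2) by (simp add: sq_dist_eq)
    ultimately show ?thesis using lap[OF that(1)] mult_pos_pos[OF e, of "laplacian b x"] by simp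
  qed
  have w_nonneg: "w x \<ge> 0" if "x \<in> A" for x
  proof (rule ccontr)
    assume "\<not> w x \<ge> 0"
    have "compact A" unfolding A_def by (intro compact_diff) auto
    moreover have "continuous_on A w"
      using smooth_on_continuous[OF smw] AS continuous_on_subset by blast
    ultimately obtain z where z: "z \<in> A" "\<And>x. x \<in> A \<Longrightarrow> w z \<le> w x"
      using continuous_attains_inf[of A w] \<open>x \<in> A\<close> by blast
    have "w z < 0" using z(2)[OF that] \<open>\<not> w x \<ge> 0\<close> by linarith
    have "dist y z \<noteq> r"
    proof
      assume "dist y z = r"
      then have "w z = g z - m" by (simp add: w_def b_def sq_dist_eq)
      then show False using geq[of z] \<open>w z < 0\<close> \<open>dist y z = r\<close> by simp
    qed
    moreover have "dist y z \<noteq> r / 2"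
    proof
      assume d: "dist y z = r / 2"
      have "(r/2)\<^sup>2 powr ?N * (r/2)\<^sup>2 powr (- ?N) = 1"
        using r by (simp add: powr_add[symmetric])
      then have "e * b z = g z0 - m" by (simp add: e_def b_def sq_dist_eq d)
      moreover have "e * (r\<^sup>2) powr (- ?N) \<ge> 0" using e by simp
      ultimately show False using z0(2)[OF d] \<open>w z < 0\<close> by (simp add: w_def)
    qed
    ultimately have zi: "z \<in> ball y r - cball y (r/2)" using z(1) by (auto simp: A_def)
    have "laplacian w z \<ge> 0" unfolding laplacian_def
    proof (intro sum_nonneg second_partial_nonneg_at_min[where S = "ball y r - cball y (r/2)"])
      show "smooth_on (ball y r - cball y (r/2)) w"
        by (rule smooth_on_subset[OF smw]) (use AS r in \<open>auto simp: A_def subset_eq\<close>)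
    qed (use zi z in \<open>auto simp: A_def\<close>)
    moreover have "z \<noteq> y" using zi r by auto
    ultimately show False using w_lap[of z] zi by auto
  qed
  have x0S: "x0 \<in> S" using U x0 r by (auto simp: S_def)
  have x0y: "x0 \<noteq> y" using x0 r by auto
  have wd: "(w has_derivative frechet_derivative w (at x0)) (at x0)"
    using smooth_on_differentiable[OF smw x0S] by (simp add: frechet_derivative_works)
  have "((\<lambda>t. x0 + t *\<^sub>R (y - x0)) has_derivative (\<lambda>t. t *\<^sub>R (y - x0))) (at 0)"
    by (auto intro!: derivative_eq_intros)
  from diff_chain_at[OF this, of w "frechet_derivative w (at x0)"] wd
  have "((\<lambda>t. w (x0 + t *\<^sub>R (y - x0))) has_derivative (\<lambda>t. frechet_derivative w (at x0) (t *\<^sub>R (y - x0)))) (at 0)"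
    by (simp add: o_def)
  then have ray: "((\<lambda>t. w (x0 + t *\<^sub>R (y - x0))) has_real_derivative frechet_derivative w (at x0) (y - x0)) (at 0)"
    using linear_frechet_derivative[OF smooth_on_differentiable[OF smw x0S]]
    by (simp add: has_field_derivative_def linear_cmul mult_commute_abs)
  have w0: "w x0 = 0" using x0 by (simp add: w_def b_def sq_dist_eq)
  have "frechet_derivative w (at x0) (y - x0) \<ge> 0"
  proof (rule ccontr)
    assume "\<not> ?thesis"
    then obtain d where d: "d > 0" "\<And>h. 0 < h \<Longrightarrow> h < d \<Longrightarrow> w (x0 + h *\<^sub>R (y - x0)) < 0"
      using DERIV_neg_dec_right[OF ray] w0 by auto
    define t where "t = min d (1/2) / 2"
    have t: "0 < t" "t < d" "t < 1/2" using d by (auto simp: t_def)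
    have "dist y (x0 + t *\<^sub>R (y - x0)) = norm ((1 - t) *\<^sub>R (y - x0))"
      by (simp add: dist_norm algebra_simps)
    then have "dist y (x0 + t *\<^sub>R (y - x0)) = (1 - t) * r" using t x0 by (simp add: dist_norm)
    moreover have "(1 - t) * r \<le> 1 * r" "(1/2) * r \<le> (1 - t) * r"
      using t r by (intro mult_right_mono; simp)+
    ultimately have "x0 + t *\<^sub>R (y - x0) \<in> A"
      by (simp add: A_def)
    then show False using w_nonneg d(2) t by fastforce
  qed
  also have "frechet_derivative w (at x0) (y - x0) =
      (\<Sum>i\<in>UNIV. (y - x0) $ i * partial_derivative i w x0)"
    by (rule frechet_derivative_eq_sum[OF smooth_on_differentiable[OF smw x0S]])
  also have "\<dots> = (\<Sum>i\<in>UNIV. (y - x0) $ i * (partial_derivative i g x0 + (- e) * partial_derivative i b x0))"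
  proof (intro sum.cong refl arg_cong2[where f = "(*)"])
    fix i
    have dg: "g differentiable (at x0)" and db: "b differentiable (at x0)"
      using sm x0S smooth_on_differentiable by auto
    have de: "(\<lambda>x. (- e) * b x) differentiable (at x0)"
      by (intro differentiable_mult differentiable_const db)
    show "partial_derivative i w x0 = partial_derivative i g x0 + (- e) * partial_derivative i b x0"
      unfolding w_def partial_derivative_add[OF differentiable_add[OF dg de] differentiable_const]
        partial_derivative_add[OF dg de] partial_derivative_mult[OF differentiable_const db]
      by simp
  qed
  also have "\<dots> = (\<Sum>i\<in>UNIV. (y - x0) $ i * partial_derivative i g x0) - e * (\<Sum>i\<in>UNIV. (y - x0) $ i * partial_derivative i b x0)"
    unfolding sum_distrib_left sum_subtractf[symmetric]
    by (intro sum.cong refl) (simp add: algebra_simps)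
  also have "(\<Sum>i\<in>UNIV. (y - x0) $ i * partial_derivative i b x0) =
     (\<Sum>i\<in>UNIV. 2 * ?N * sq_dist y x0 powr (- ?N - 1) * ((x0 $ i - y $ i) * (x0 $ i - y $ i)))"
    unfolding b_def[abs_def] partial_derivative_sq_dist_powr[OF x0y]
    by (intro sum.cong refl) (simp add: algebra_simps)
  also have "\<dots> = 2 * ?N * sq_dist y x0 powr (- ?N - 1) * sq_dist y x0"
    by (simp add: sum_distrib_left[symmetric] sq_dist_def)
  finally have "e * (2 * ?N * sq_dist y x0 powr (- ?N - 1) * sq_dist y x0)
      \<le> (\<Sum>i\<in>UNIV. (y - x0) $ i * partial_derivative i g x0)" by simp
  moreover have "e * (2 * ?N * sq_dist y x0 powr (- ?N - 1) * sq_dist y x0) > 0"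
    using e x0y by (simp add: sq_dist_eq)
  moreover have "frechet_derivative g (at x0) (x0 - y) = (\<Sum>i\<in>UNIV. (x0 - y) $ i * partial_derivative i g x0)"
    by (rule frechet_derivative_eq_sum[OF smooth_on_differentiable[OF sm(1) x0S]])
  moreover have "\<dots> = - (\<Sum>i\<in>UNIV. (y - x0) $ i * partial_derivative i g x0)"
    unfolding sum_negf[symmetric] by (intro sum.cong refl) (simp add: algebra_simps)
  ultimately show ?thesis by linarith
qed

text \<open>If the minimum set \<open>Z\<close> in the open ball is neither empty nor everything, it is not open, so a ball
  free of \<open>Z\<close> touches it at an interior point. There Hopf's lemma contradicts the vanishing of the
  derivative. If \<open>Z\<close> is empty, Hopf's lemma on the unit ball contradicts the sign condition at \<open>x0\<close>.\<close>
lemma strong_minimum_principle: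
  fixes g :: "real^'n \<Rightarrow> real"
  assumes U: "open U" "smooth_on U g" "cball 0 1 \<subseteq> U"
    and lap: "\<And>x. x \<in> ball 0 1 \<Longrightarrow> laplacian g x \<le> 0"
    and geq: "\<And>x. x \<in> cball 0 1 \<Longrightarrow> g x \<ge> m"
    and x0: "x0 \<in> cball 0 1" "g x0 = m" "x0 \<in> sphere 0 1 \<Longrightarrow> frechet_derivative g (at x0) x0 \<ge> 0"
    and x: "x \<in> cball 0 1"
  shows "g x = m"
proof -
  let ?B = "ball (0::real^'n) 1"
  define Z where "Z = {x \<in> ?B. g x = m}"
  have gcont: "continuous_on (cball 0 1) g"
    using U smooth_on_continuous continuous_on_subset by blast
  have "Z = ?B"
  proof (rule ccontr)
    assume "Z \<noteq> ?B"
    show False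
    proof (cases "Z = {}")
      case True
      then have "x0 \<in> sphere 0 1" using x0 by (auto simp: Z_def order_le_less)
      moreover have "frechet_derivative g (at x0) (x0 - 0) < 0"
      proof (rule hopf_boundary_point[where r = 1 and m = m])
        show "g x > m" if "x \<in> ?B" for x
          using True geq[of x] that by (auto simp: Z_def order_le_less)
      qed (use U lap x0 calculation in auto)
      ultimately show False using x0(3) by simp
    next
      case False
      have "closedin (top_of_set ?B) Z" unfolding Z_def
        by (rule continuous_closedin_preimage_constant[OF continuous_on_subset[OF gcont]]) auto
      then have "\<not> openin (top_of_set ?B) Z"
        using False \<open>Z \<noteq> ?B\<close> connected_ball[of "0::real^'n" 1] unfolding connected_clopen by blast
      then obtain z where z: "z \<in> Z" "\<And>d. d > 0 \<Longrightarrow> \<not> (ball z d \<inter> ?B \<subseteq> Z)"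
        unfolding openin_contains_ball using Z_def by auto
      obtain d where d: "d > 0" "ball z d \<subseteq> ?B"
        using z(1) open_contains_ball[of ?B] by (metis (mono_tags, lifting) Z_def mem_Collect_eq open_ball)
      obtain y where y: "y \<in> ball z (d/2)" "y \<in> ?B" "y \<notin> Z"
        using z(2)[of "d/2", simplified, OF d(1)] by blast
      define K where "K = {x \<in> cball y (dist y z). g x = m}"
      have near: "cball y (dist y z) \<subseteq> ball z d"
      proof
        fix x assume "x \<in> cball y (dist y z)"
        then have "dist z x \<le> dist z y + dist z y"
          using dist_triangle[of z x y] by (simp add: dist_commute)
        then show "x \<in> ball z d" using y(1) by simp
      qed
      have "closed K" unfolding K_def
        by (rule continuous_closed_preimage_constant[OF continuous_on_subset[OF gcont]])
          (use near d(2) in auto)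
      moreover have "z \<in> K" using z(1) by (simp add: K_def Z_def)
      ultimately obtain x1 where x1: "x1 \<in> K" "\<And>x. x \<in> K \<Longrightarrow> dist y x1 \<le> dist y x"
        using distance_attains_inf[of K y] by blast
      define r where "r = dist y x1"
      have r: "r > 0" "r \<le> dist y z"
        using x1(1) y by (auto simp: r_def K_def Z_def)
      have inB: "cball y r \<subseteq> ?B" using subset_cball[OF r(2), of y] near d(2) by blast
      then have x1B: "x1 \<in> ?B" by (auto simp: r_def)
      have "frechet_derivative g (at x1) (x1 - y) < 0"
      proof (rule hopf_boundary_point[where r = r and m = m])
        show "cball y r \<subseteq> U" using inB U(3) ball_subset_cball by blast
        show "g x > m" if "x \<in> ball y r" for x
        proof -
          have "dist y x < r" "x \<in> ?B" using that inB ball_subset_cball[of y r] by (simp, blast)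
          then have "g x \<noteq> m" using x1(2)[of x] r(2) by (auto simp: r_def K_def)
          then show ?thesis using geq[of x] \<open>x \<in> ?B\<close> by simp
        qed
        show "laplacian g x \<le> 0" if "x \<in> ball y r" for x
          using that inB lap ball_subset_cball[of y r] by blast
      qed (use U r x1 in \<open>auto simp: r_def K_def\<close>)
      moreover have "frechet_derivative g (at x1) = (\<lambda>v. 0)"
      proof (rule differential_zero_maxmin[OF x1B open_ball])
        show "(g has_derivative frechet_derivative g (at x1)) (at x1)"
          using smooth_on_differentiable[OF U(2), of x1] x1B U(3)
          by (auto simp: frechet_derivative_works[symmetric] subset_eq)
        show "(\<forall>y\<in>?B. g y \<le> g x1) \<or> (\<forall>y\<in>?B. g x1 \<le> g y)"
          using x1(1) geq by (auto simp: K_def)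
      qed
      ultimately show False by simp
    qed
  qed
  have inZ: "g y = m" if "y \<in> ?B" for y
  proof -
    have "y \<in> Z" using that unfolding \<open>Z = ?B\<close> .
    then show ?thesis by (simp add: Z_def)
  qed
  have "x \<in> closure ?B" using x closure_ball[of 1 "0::real^'n"] by simp
  moreover have "continuous_on (closure ?B) g" using gcont closure_ball[of 1 "0::real^'n"] by simp
  ultimately show ?thesis
    using continuous_constant_on_closure[of ?B g m x, OF _ inZ] by blast
qed

section \<open>Divergence on the unit ball\<close>

text \<open>By translation invariance of Lebesgue measure the difference quotients in direction \<open>i\<close> have integral
  zero, and they converge boundedly, with supports in a fixed ball.\<close>
lemma integral_partial_derivative_eq_0:
  fixes w :: "real^'n \<Rightarrow> real"
  assumes d: "\<And>x. w differentiable (at x)"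
    and cont: "continuous_on UNIV (partial_derivative i w)"
    and supp: "\<And>x. norm x > 1 \<Longrightarrow> w x = 0"
  shows "integrable lborel (partial_derivative i w)" "(\<integral>x. partial_derivative i w x \<partial>lborel) = 0"
proof -
  let ?e = "axis i (1::real)"
  define t where "t k = 1 / real (Suc k)" for k
  have t: "0 < t k" "t k \<le> 1" for k by (auto simp: t_def)
  define s where "s k x = (w (x + t k *\<^sub>R ?e) - w x) / t k" for k x
  have wcont: "continuous_on UNIV w"
    using d by (auto intro!: differentiable_imp_continuous_on simp: differentiable_on_def)
  have wmeas[measurable]: "w \<in> borel_measurable borel"
    using wcont by (rule borel_measurable_continuous_onI)
  have dmeas: "partial_derivative i w \<in> borel_measurable borel"
    using cont by (rule borel_measurable_continuous_onI)
  have wind: "w = (\<lambda>x. indicator (cball 0 1) x *\<^sub>R w x)"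
    using supp by (auto simp: fun_eq_iff indicator_def)
  have wint: "integrable lborel w"
    by (subst wind, rule borel_integrable_compact) (auto intro: continuous_on_subset[OF wcont])
  have shift: "integrable lborel (\<lambda>x. w (x + c))" "(\<integral>x. w (x + c) \<partial>lborel) = (\<integral>x. w x \<partial>lborel)" for c
    using wint integrable_distr_eq[of "(+) c" lborel borel w] integral_distr[of "(+) c" lborel borel w]
    by (simp_all add: lborel_distr_plus add.commute)
  have s0: "(\<integral>x. s k x \<partial>lborel) = 0" for k
    unfolding s_def using shift wint by simp
  have "compact ((\<lambda>x. partial_derivative i w x) ` cball 0 3)"
    by (intro compact_continuous_image continuous_on_subset[OF cont]) auto
  then obtain M where M: "\<And>x. norm x \<le> 3 \<Longrightarrow> \<bar>partial_derivative i w x\<bar> \<le> M"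
    using compact_imp_bounded bounded_iff by (metis imageI mem_cball_0 real_norm_def)
  have bound: "norm (s k x) \<le> M * indicator (cball 0 2) x" for k x
  proof (cases "norm x \<le> 2")
    case True
    have "\<exists>z>0. z < t k \<and> w (x + t k *\<^sub>R ?e) - w (x + 0 *\<^sub>R ?e) = (t k - 0) * partial_derivative i w (x + z *\<^sub>R ?e)"
      using t by (intro MVT2 partial_derivative_line d) auto
    then obtain z where z: "0 < z" "z < t k" "s k x = partial_derivative i w (x + z *\<^sub>R ?e)"
      using t[of k] by (auto simp: s_def)
    have "norm (x + z *\<^sub>R ?e) \<le> 3"
      using norm_triangle_ineq[of x "z *\<^sub>R ?e"] z t[of k] True by (simp add: norm_axis_1)
    then show ?thesis using M z True by simp
  next
    case False
    have "norm x \<le> norm (x + t k *\<^sub>R ?e) + norm (t k *\<^sub>R ?e)"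
      using norm_triangle_ineq4[of "x + t k *\<^sub>R ?e" "t k *\<^sub>R ?e"] by simp
    then have "norm (x + t k *\<^sub>R ?e) > 1"
      using False t[of k] by (simp add: norm_axis_1)
    then show ?thesis using False supp by (simp add: s_def)
  qed
  have lim: "(\<lambda>k. s k x) \<longlonglongrightarrow> partial_derivative i w x" for x
  proof -
    have D: "((\<lambda>r. w (x + r *\<^sub>R ?e)) has_real_derivative partial_derivative i w x) (at 0)"
      using partial_derivative_line[of w x 0 i] d by simp
    then have L: "((\<lambda>h. (w (x + h *\<^sub>R ?e) - w x) / h) \<longlongrightarrow> partial_derivative i w x) (at 0)"
      by (simp add: DERIV_def)
    have "t \<longlonglongrightarrow> 0" unfolding t_def by (rule LIMSEQ_Suc[OF lim_1_over_n])
    moreover have "\<forall>k. t k \<noteq> 0" using t less_irrefl by metis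
    ultimately have "filterlim t (at 0) sequentially"
      by (intro filterlim_atI) auto
    then show ?thesis unfolding s_def by (rule filterlim_compose[OF L])
  qed
  have Mint: "integrable lborel (\<lambda>x::real^'n. M * indicator (cball 0 2) x :: real)"
    by (intro integrable_mult_right integrable_real_indicator) (use emeasure_bounded_finite[OF bounded_cball[of "0::real^'n" 2]] in auto)
  have smeas: "s k \<in> borel_measurable lborel" for k unfolding s_def[abs_def] by measurable
  show "integrable lborel (partial_derivative i w)"
    by (rule integrable_dominated_convergence[where s = s, OF _ smeas Mint]) (use dmeas lim bound in auto)
  have "(\<lambda>k. \<integral>x. s k x \<partial>lborel) \<longlonglongrightarrow> (\<integral>x. partial_derivative i w x \<partial>lborel)"
    by (rule integral_dominated_convergence[where s = s, OF _ smeas Mint]) (use dmeas lim bound in auto)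
  then show "(\<integral>x. partial_derivative i w x \<partial>lborel) = 0"
    unfolding s0 using LIMSEQ_unique tendsto_const by blast
qed

lemma has_derivative_square_pos_part:
  "((\<lambda>t::real. (max 0 t)\<^sup>2) has_real_derivative 2 * max 0 t) (at t)"
proof -
  consider "t > 0" | "t < 0" | "t = 0" by linarith
  then show ?thesis
  proof cases
    case 1
    have "((\<lambda>t::real. t\<^sup>2) has_real_derivative 2 * t) (at t)" by (auto intro!: derivative_eq_intros)
    then show ?thesis using 1
      by (subst DERIV_cong_ev[where g = "\<lambda>t. t\<^sup>2" and y = t])
        (auto intro: eventually_mono[OF eventually_gt_at_top] eventually_nhds_in_open[of "{0<..}", THEN eventually_mono])
  next
    case 2
    then show ?thesis
      by (subst DERIV_cong_ev[where g = "\<lambda>t. 0" and y = t])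
        (auto intro: eventually_nhds_in_open[of "{..<0}", THEN eventually_mono])
  next
    case 3
    have "((\<lambda>h::real. max 0 h * (max 0 h / h)) \<longlongrightarrow> 0) (at 0)"
    proof (rule Lim_null_comparison)
      show "\<forall>\<^sub>F h::real in at 0. norm (max 0 h * (max 0 h / h)) \<le> \<bar>h\<bar>"
        by (intro always_eventually) (auto simp: max_def)
      show "((\<lambda>h::real. \<bar>h\<bar>) \<longlongrightarrow> 0) (at 0)" by (intro tendsto_eq_intros refl) auto
    qed
    then show ?thesis using 3 by (simp add: DERIV_def power2_eq_square)
  qed
qed

text \<open>A continuously differentiable radial cutoff without case distinctions, built from the positive part
  squared: for \<open>c = (1 - r\<^sup>2)\<^sup>2\<close> it is constantly \<open>c\<^sup>2\<close> for \<open>|x| \<le> r\<close>, decreases to \<open>0\<close> at \<open>|x| = 1\<close> and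
  stays \<open>0\<close> outside. Its gradient is \<open>-cutoff_slope c x\<close> times \<open>x\<close>.\<close>
definition cutoff :: "real \<Rightarrow> real^'n \<Rightarrow> real" where
  "cutoff c x = c\<^sup>2 - (max 0 (c - (max 0 (1 - sq_dist 0 x))\<^sup>2))\<^sup>2"

definition cutoff_slope :: "real \<Rightarrow> real^'n \<Rightarrow> real" where
  "cutoff_slope c x = 8 * max 0 (c - (max 0 (1 - sq_dist 0 x))\<^sup>2) * max 0 (1 - sq_dist 0 x)"

lemma cutoff_differentiable: "cutoff c differentiable (at x)"
  and partial_derivative_cutoff: "partial_derivative i (cutoff c) x = - cutoff_slope c x * x $ i"
proof -
  have D: "(sq_dist 0 has_derivative frechet_derivative (sq_dist 0) (at x)) (at x)"
    using smooth_on_differentiable[OF smooth_on_sq_dist[OF open_UNIV]]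
    by (simp add: frechet_derivative_works)
  have P: "((\<lambda>t. c\<^sup>2 - (max 0 (c - (max 0 (1 - t))\<^sup>2))\<^sup>2) has_real_derivative
      - (2 * max 0 (c - (max 0 (1 - t))\<^sup>2) * (- (2 * max 0 (1 - t) * (- 1))))) (at t)" for t
    by (rule derivative_eq_intros DERIV_chain2[OF has_derivative_square_pos_part] refl)+ auto
  have "(cutoff c has_derivative (\<lambda>h. - (2 * max 0 (c - (max 0 (1 - sq_dist 0 x))\<^sup>2) *
     (2 * max 0 (1 - sq_dist 0 x))) * frechet_derivative (sq_dist 0) (at x) h)) (at x)"
    unfolding cutoff_def[abs_def]
    using diff_chain_at[OF D P[unfolded has_field_derivative_def]] by (simp add: o_def)
  from differentiableI[OF this] partial_derivative_eq[OF this, of i]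
  show "cutoff c differentiable (at x)"
    "partial_derivative i (cutoff c) x = - cutoff_slope c x * x $ i"
    using partial_derivative_sq_dist[of i 0 x]
    by (simp_all add: cutoff_slope_def partial_derivative_def[of i "sq_dist 0"])
qed

lemma continuous_on_cutoff: "continuous_on S (cutoff c)" "continuous_on S (cutoff_slope c)"
  using continuous_on_subset[OF smooth_on_continuous[OF smooth_on_sq_dist[OF open_UNIV, of 0]], of S]
  unfolding cutoff_def[abs_def] cutoff_slope_def[abs_def]
  by (auto intro!: continuous_intros)

lemma cutoff_outside: "norm x \<ge> 1 \<Longrightarrow> c \<ge> 0 \<Longrightarrow> cutoff c x = 0 \<and> cutoff_slope c x = 0"
  using power_mono[of 1 "norm x" 2] by (simp add: cutoff_def cutoff_slope_def sq_dist_eq max_absorb1)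

lemma cutoff_inside:
  assumes "norm x \<le> r" "r \<le> 1" "c = (1 - r\<^sup>2)\<^sup>2"
  shows "cutoff c x = c\<^sup>2 \<and> cutoff_slope c x = 0"
proof -
  have "(norm x)\<^sup>2 \<le> r\<^sup>2" using assms by (intro power_mono) auto
  moreover have "0 \<le> r" using assms(1) norm_ge_zero[of x] by linarith
  then have "r\<^sup>2 \<le> 1" using assms(2) power_mono[of r 1 2] by simp
  ultimately have "(1 - r\<^sup>2)\<^sup>2 \<le> (max 0 (1 - (norm x)\<^sup>2))\<^sup>2" by (intro power_mono) auto
  then show ?thesis using assms(3) by (simp add: cutoff_def cutoff_slope_def sq_dist_eq)
qed

lemma cutoff_bounds:
  assumes "c \<ge> 0" shows "0 \<le> cutoff c x" "cutoff c x \<le> c\<^sup>2" "0 \<le> cutoff_slope c x"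
  using assms power_mono[of "max 0 (c - (max 0 (1 - sq_dist 0 x))\<^sup>2)" c 2]
  by (auto simp: cutoff_def cutoff_slope_def)

lemma differentiable_cong_open:
  assumes "f differentiable (at x)" "open S" "x \<in> S" "\<And>y. y \<in> S \<Longrightarrow> f y = g y"
  shows "g differentiable (at x)"
  using assms has_derivative_transform_within_open unfolding differentiable_def by metis

text \<open>The function \<open>D\<close> is the divergence of the cutoff times \<open>G\<close>, a compactly supported field.\<close>
lemma integral_cutoff_divergence:
  fixes G :: "'n \<Rightarrow> real^'n \<Rightarrow> real"
  assumes V: "open V" "cball 0 1 \<subseteq> V" and G: "\<And>i. smooth_on V (G i)" and c: "c \<ge> 0"
  defines "D \<equiv> \<lambda>x. if x \<in> V then cutoff c x * (\<Sum>i\<in>UNIV. partial_derivative i (G i) x)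
              - cutoff_slope c x * (\<Sum>i\<in>UNIV. x $ i * G i x) else 0"
  shows "integrable lborel D" "(\<integral>x. D x \<partial>lborel) = 0"
proof -
  define w where "w i x = (if x \<in> V then cutoff c x * G i x else 0)" for i x
  have w0: "w i x = 0" if "norm x \<ge> 1" for i x
    using that c by (simp add: w_def cutoff_outside)
  have out: "open (- cball (0::real^'n) 1)" by (intro open_Compl closed_cball)
  have UNIV: "x \<in> V \<or> x \<in> - cball 0 1" for x using V(2) by auto
  have wV: "w i differentiable (at x)"
    "partial_derivative i (w i) x = cutoff c x * partial_derivative i (G i) x - cutoff_slope c x * x $ i * G i x"
    if "x \<in> V" for i x
  proof -
    have g: "G i differentiable (at x)" using smooth_on_differentiable[OF G that] .
    have "(\<lambda>x. cutoff c x * G i x) differentiable (at x)"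
      by (intro differentiable_mult cutoff_differentiable g)
    then show "w i differentiable (at x)"
      by (rule differentiable_cong_open[OF _ V(1) that]) (simp add: w_def)
    have "partial_derivative i (w i) x = partial_derivative i (\<lambda>x. cutoff c x * G i x) x"
      by (rule partial_derivative_cong[OF V(1) that]) (simp add: w_def)
    then show "partial_derivative i (w i) x = cutoff c x * partial_derivative i (G i) x - cutoff_slope c x * x $ i * G i x"
      by (simp add: partial_derivative_mult[OF cutoff_differentiable g] partial_derivative_cutoff)
  qed
  have wout: "w i differentiable (at x)" "partial_derivative i (w i) x = 0"
    if "x \<in> - cball 0 1" for i x
  proof -
    show "w i differentiable (at x)"
      by (rule differentiable_cong_open[OF differentiable_const[of 0] out that]) (simp add: w0)
    have "partial_derivative i (w i) x = partial_derivative i (\<lambda>x. 0) x"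
      by (rule partial_derivative_cong[OF out that]) (simp add: w0)
    then show "partial_derivative i (w i) x = 0" by simp
  qed
  have wd: "w i differentiable (at x)" for i x using UNIV[of x] wV(1) wout(1) by blast
  have "continuous_on V (partial_derivative i (w i))" for i
  proof -
    have "continuous_on V (\<lambda>x. cutoff c x * partial_derivative i (G i) x - cutoff_slope c x * x $ i * G i x)"
      using G by (intro continuous_intros continuous_on_cutoff)
        (auto intro: smooth_on_continuous smooth_on_partial)
    then show ?thesis by (rule continuous_on_eq) (simp add: wV(2))
  qed
  moreover have "continuous_on (- cball 0 1) (partial_derivative i (w i))" for i
    by (rule continuous_on_eq[OF continuous_on_const[of _ 0]]) (simp add: wout(2))
  ultimately have "continuous_on (V \<union> - cball 0 1) (partial_derivative i (w i))" for i
    using continuous_on_open_Un[OF V(1) out] by blast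
  moreover have "V \<union> - cball 0 1 = UNIV" using UNIV by blast
  ultimately have "integrable lborel (partial_derivative i (w i))"
    "(\<integral>x. partial_derivative i (w i) x \<partial>lborel) = 0" for i
    using integral_partial_derivative_eq_0[OF wd] w0 by (metis less_imp_le)+
  then have "integrable lborel (\<lambda>x. \<Sum>i\<in>UNIV. partial_derivative i (w i) x)"
    "(\<integral>x. (\<Sum>i\<in>UNIV. partial_derivative i (w i) x) \<partial>lborel) = 0"
    by simp_all
  moreover have "(\<lambda>x. \<Sum>i\<in>UNIV. partial_derivative i (w i) x) = D"
  proof
    fix x
    show "(\<Sum>i\<in>UNIV. partial_derivative i (w i) x) = D x"
    proof (cases "x \<in> V")
      case True
      then show ?thesis
        by (simp add: wV(2) D_def sum_subtractf sum_distrib_left mult.assoc)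
    next
      case False
      then show ?thesis using UNIV[of x] by (simp add: wout(2) D_def)
    qed
  qed
  ultimately show "integrable lborel D" "(\<integral>x. D x \<partial>lborel) = 0" by simp_all
qed

text \<open>Were the divergence positive at \<open>x1\<close>, its weighted integrals would stay positive after replacing \<open>F\<close>
  by \<open>G = F - \<delta>x\<close> for small \<open>\<delta>\<close>. But \<open>G\<close> points strictly inward on the sphere, hence on a whole shell
  \<open>r < |x| \<le> 1\<close>. Multiply \<open>G\<close> by a radial cutoff that varies only on this shell. The
  divergence of the product has integral \<open>0\<close>, and the term with the gradient of the cutoff is nonnegative; so the
  integral of the divergence of \<open>G\<close> weighted by the cutoff is at most \<open>0\<close>, a contradiction.\<close>
lemma divergence_eq_0:
  fixes F :: "'n \<Rightarrow> real^'n \<Rightarrow> real"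
  assumes V: "open V" "cball 0 1 \<subseteq> V" and F: "\<And>i. smooth_on V (F i)"
    and div: "\<And>x. x \<in> ball 0 1 \<Longrightarrow> 0 \<le> (\<Sum>i\<in>UNIV. partial_derivative i (F i) x)"
    and inward: "\<And>x. x \<in> sphere 0 1 \<Longrightarrow> (\<Sum>i\<in>UNIV. x $ i * F i x) \<le> 0"
    and x1: "x1 \<in> ball 0 1"
  shows "(\<Sum>i\<in>UNIV. partial_derivative i (F i) x1) = 0"
proof (rule ccontr)
  let ?N = "real CARD('n)"
  let ?vol = "measure lborel :: (real^'n) set \<Rightarrow> real"
  define divF where "divF x = (\<Sum>i\<in>UNIV. partial_derivative i (F i) x)" for x
  assume neq: "(\<Sum>i\<in>UNIV. partial_derivative i (F i) x1) \<noteq> 0"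
  define e where "e = divF x1 / 2"
  have e: "e > 0" "e < divF x1"
    using neq div[OF x1] by (auto simp: e_def divF_def)
  have divcont: "continuous_on V divF" unfolding divF_def
    using F by (intro continuous_intros smooth_on_continuous[OF smooth_on_partial])
  then have "continuous_on (ball 0 1) divF"
    by (rule continuous_on_subset) (use V(2) in auto)
  then have "open (ball 0 1 \<inter> divF -` {e<..})"
    by (intro continuous_open_preimage) auto
  then obtain s0 where s0: "s0 > 0" "ball x1 s0 \<subseteq> ball 0 1 \<inter> divF -` {e<..}"
    using x1 e open_contains_ball by (metis IntI greaterThan_iff vimageI)
  define s where "s = min s0 (1 - norm x1) / 2"
  have s: "s > 0" "s < s0" "norm x1 + s < 1" using s0 x1 by (auto simp: s_def min_def field_simps)
  have near: "norm x \<le> norm x1 + s" "divF x > e" if "x \<in> ball x1 s" for x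
  proof -
    show "norm x \<le> norm x1 + s"
      using that norm_triangle_ineq[of x1 "x - x1"] by (simp add: dist_norm norm_minus_commute)
    show "divF x > e" using s0(2) s(2) that by (auto simp: subset_eq)
  qed
  have vol: "?vol (ball x1 s) > 0" "?vol (cball 0 1) > 0"
    using s(1) content_ball_pos content_cball_pos[of 1 "0::real^'n"] by (auto simp: measure_completion)
  \<comment> \<open>Half of what the positive divergence near \<open>x1\<close> can pay for: subtracting \<open>\<delta>x\<close> costs \<open>n\<delta>\<close> per unit volume.\<close>
  define \<delta> where "\<delta> = e * ?vol (ball x1 s) / (2 * ?N * ?vol (cball 0 1))"
  have \<delta>: "\<delta> > 0" using vol e by (simp add: \<delta>_def)
  define G where "G i x = F i x - \<delta> * x $ i" for i x
  have G: "smooth_on V (G i)" for i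
    unfolding G_def[abs_def] using V F
    by (intro smooth_on_diff smooth_on_mult smooth_on_const smooth_on_component)
  have divG: "(\<Sum>i\<in>UNIV. partial_derivative i (G i) x) = divF x - ?N * \<delta>" if "x \<in> V" for x
  proof -
    have x: "(\<lambda>x::real^'n. x $ i) differentiable (at x)" for i
      by (rule smooth_on_differentiable[OF smooth_on_component, of _ UNIV]) simp
    have "partial_derivative i (G i) x = partial_derivative i (F i) x - \<delta>" for i
      unfolding G_def[abs_def]
      using smooth_on_differentiable[OF F that, of i] x
      by (simp add: partial_derivative_diff partial_derivative_mult partial_derivative_component differentiable_mult)
    then show ?thesis by (simp add: divF_def sum_subtractf)
  qed
  define q where "q x = (\<Sum>i\<in>UNIV. x $ i * G i x)" for x
  have qcont: "continuous_on (cball 0 1) q"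
    unfolding q_def using continuous_on_subset[OF smooth_on_continuous[OF G] V(2)]
    by (intro continuous_intros)
  \<comment> \<open>The points where \<open>G\<close> is not strictly inward form a compact set inside the open ball.\<close>
  define K where "K = {x \<in> cball 0 1. q x \<ge> 0}"
  have "closed K" unfolding K_def
    using continuous_closed_preimage[OF qcont closed_cball closed_atLeast, of 0]
    by (simp add: vimage_def Int_def)
  then have "compact K"
    by (auto simp: compact_eq_bounded_closed K_def intro: bounded_subset[OF bounded_cball[of 0 1]])
  have Kin: "norm x < 1" if "x \<in> K" for x
  proof (rule ccontr)
    assume "\<not> norm x < 1"
    then have x: "norm x = 1" using that by (auto simp: K_def)
    have "q x = (\<Sum>i\<in>UNIV. x $ i * F i x) - \<delta> * (\<Sum>i\<in>UNIV. x $ i * x $ i)"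
      by (simp add: q_def G_def algebra_simps sum_subtractf sum_distrib_left)
    also have "(\<Sum>i\<in>UNIV. x $ i * x $ i) = 1"
      using x by (simp add: norm_eq_1 inner_vec_def)
    finally have "q x < 0" using inward[of x] x \<delta> by simp
    then show False using that by (simp add: K_def)
  qed
  have "\<exists>r0<1. \<forall>x\<in>K. norm x \<le> r0"
  proof (cases "K = {}")
    case False
    have "continuous_on K norm" by (intro continuous_intros)
    with False obtain z where "z \<in> K" "\<forall>x\<in>K. norm x \<le> norm z"
      using continuous_attains_sup[OF \<open>compact K\<close>] by blast
    then show ?thesis using Kin by blast
  qed (auto intro: exI[of _ 0])
  then obtain r0 where r0: "r0 < 1" "\<And>x. x \<in> K \<Longrightarrow> norm x \<le> r0" by blast
  define r where "r = max r0 (norm x1 + s)"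
  have r: "r < 1" "r0 \<le> r" "norm x1 + s \<le> r" "0 \<le> r"
    using r0 s order_trans[OF norm_ge_zero[of x1]] by (auto simp: r_def le_max_iff_disj)
  define c where "c = (1 - r\<^sup>2)\<^sup>2"
  have "r\<^sup>2 < 1" using r by (simp add: power_less_one_iff abs_square_less_1)
  then have c: "c > 0" by (simp add: c_def)
  define D where "D x = (if x \<in> V then cutoff c x * (\<Sum>i\<in>UNIV. partial_derivative i (G i) x)
              - cutoff_slope c x * (\<Sum>i\<in>UNIV. x $ i * G i x) else 0)" for x
  have D: "integrable lborel D" "(\<integral>x. D x \<partial>lborel) = 0"
    unfolding D_def using integral_cutoff_divergence[OF V G, of c] c by auto
  define h where "h x = c\<^sup>2 * (e * indicator (ball x1 s) x - ?N * \<delta> * indicator (cball 0 1) x)" for x :: "real^'n"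
  have ints: "integrable lborel (\<lambda>x. indicator (ball x1 s) x :: real)"
    "integrable lborel (\<lambda>x::real^'n. indicator (cball 0 1) x :: real)"
    using emeasure_bounded_finite[OF bounded_cball[of "0::real^'n" 1]]
      emeasure_bounded_finite[OF bounded_ball[of x1 s]]
    by (auto intro!: integrable_real_indicator)
  have h: "integrable lborel h" "(\<integral>x. h x \<partial>lborel) = c\<^sup>2 * (e * ?vol (ball x1 s) - ?N * \<delta> * ?vol (cball 0 1))"
    unfolding h_def[abs_def] using ints by simp_all
  have "h x \<le> D x" for x
  proof (cases "x \<in> cball 0 1")
    case False
    then have "x \<notin> ball x1 s" using near(1)[of x] s by force
    then show ?thesis using False c by (simp add: h_def D_def cutoff_outside)
  next
    case True
    then have xV: "x \<in> V" using V(2) by auto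
    have slope: "cutoff_slope c x * q x \<le> 0"
    proof (cases "norm x \<le> r")
      case True
      then show ?thesis using cutoff_inside[of x r c] r by (simp add: c_def)
    next
      case False
      then have "x \<notin> K" using r0(2)[of x] r by auto
      then have "q x < 0" using True by (auto simp: K_def)
      then show ?thesis using cutoff_bounds(3)[of c x] c by (simp add: mult_nonneg_nonpos)
    qed
    have "h x \<le> cutoff c x * (divF x - ?N * \<delta>)"
    proof (cases "x \<in> ball x1 s")
      case in_s: True
      then have "cutoff c x = c\<^sup>2" using near(1) r by (intro cutoff_inside[of x r c, THEN conjunct1]) (auto simp: c_def intro: order_trans)
      then show ?thesis using near(2)[OF in_s] in_s True by (simp add: h_def mult_left_mono)
    next
      case out_s: False
      have "cutoff c x * divF x \<ge> 0"
      proof (cases "norm x < 1")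
        case True
        then show ?thesis using div[of x] cutoff_bounds[of c x] c by (simp add: divF_def)
      next
        case False
        then show ?thesis using cutoff_outside[of x c] c by simp
      qed
      moreover have "cutoff c x * (?N * \<delta>) \<le> c\<^sup>2 * (?N * \<delta>)"
        using cutoff_bounds[of c x] c \<delta> by (intro mult_right_mono) auto
      ultimately show ?thesis using out_s True by (simp add: h_def algebra_simps)
    qed
    then show ?thesis using slope xV divG[OF xV] by (simp add: D_def q_def)
  qed
  then have "(\<integral>x. h x \<partial>lborel) \<le> (\<integral>x. D x \<partial>lborel)"
    by (intro integral_mono h D)
  then have "e * ?vol (ball x1 s) \<le> ?N * \<delta> * ?vol (cball 0 1)"
    using h D c by (simp add: mult_le_0_iff)
  also have "\<dots> = e * ?vol (ball x1 s) / 2" using vol by (simp add: \<delta>_def)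
  finally show False using e vol by (simp add: field_simps mult_le_0_iff)
qed

section \<open>Obata's identity for the conformal factor\<close>

text \<open>The equations satisfied by \<open>v = u\<^bsup>-2/(n-2)\<^esup>\<close>; see \<open>quadratic_profile\<close> for the passage from \<open>u\<close> to \<open>v\<close>.\<close>
locale conformal_factor =
  fixes v :: "real^'n \<Rightarrow> real" and V :: "(real^'n) set" and kap h k :: real
  assumes V: "open V" "cball 0 1 \<subseteq> V" and v: "smooth_on V v"
    and pos: "\<And>x. x \<in> V \<Longrightarrow> v x > 0"
    and eq: "\<And>x. x \<in> ball 0 1 \<Longrightarrow> laplacian v x =
        real CARD('n) * (((\<Sum>i\<in>UNIV. (partial_derivative i v x)\<^sup>2) + k) / (2 * v x))"
    and bc: "\<And>x. x \<in> sphere 0 1 \<Longrightarrow> (\<Sum>i\<in>UNIV. x $ i * partial_derivative i v x) = kap * v x - h"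
    and kap: "0 < kap" "kap \<le> 1"
begin

abbreviation "d i \<equiv> partial_derivative i v"
abbreviation "dd i j \<equiv> partial_derivative i (partial_derivative j v)"

text \<open>Inside the ball this is \<open>\<Delta>v/n\<close>. The formula in terms of \<open>v\<close> and its gradient makes it smooth on all of
  \<open>V\<close> and shows that its gradient involves only second derivatives.\<close>
definition q :: "real^'n \<Rightarrow> real" where
  "q x = (1/2) * (((\<Sum>i\<in>UNIV. d i x * d i x) + k) * v x powr (-1))"

text \<open>Inside the ball this is the trace-free Hessian, which is up to a factor the trace-free Ricci tensor of the conformal metric
  \<open>v\<^bsup>-2\<^esup>|dx|\<^sup>2\<close>.\<close>
definition E :: "'n \<Rightarrow> 'n \<Rightarrow> real^'n \<Rightarrow> real" where
  "E i j x = dd i j x - (if i = j then 1 else 0) * q x"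

text \<open>The weight \<open>f\<close> and the coefficient \<open>h - \<kappa>v\<close> of the position field are matched: their gradients
  \<open>\<kappa>x\<close> and \<open>-\<kappa>\<nabla>v\<close> make the rank-one part of the derivative of \<open>X\<close> antisymmetric. The constants are
  chosen so that on the sphere \<open>f = 1\<close> and \<open>X\<close> is tangential.\<close>
definition f :: "real^'n \<Rightarrow> real" where
  "f x = (1 - kap / 2) + (kap / 2) * sq_dist 0 x"

definition X :: "'n \<Rightarrow> real^'n \<Rightarrow> real" where
  "X j x = f x * d j x + (h - kap * v x) * x $ j"

definition F :: "'n \<Rightarrow> real^'n \<Rightarrow> real" where
  "F i x = v x powr (1 - real CARD('n)) * (\<Sum>j\<in>UNIV. E i j x * X j x)"

lemma smooth: "smooth_on V (d i)" "smooth_on V (dd i j)" "smooth_on V q" "smooth_on V (E i j)"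
    "smooth_on V f" "smooth_on V (X j)" "smooth_on V (F i)" "smooth_on V (\<lambda>x. v x powr a)"
proof -
  show d: "smooth_on V (d i)" for i by (rule smooth_on_partial[OF v])
  show dd: "smooth_on V (dd i j)" for i j by (rule smooth_on_partial[OF d])
  show p: "smooth_on V (\<lambda>x. v x powr a)" for a by (rule smooth_on_powr[OF V(1) v pos])
  note ops = V(1) smooth_on_mult smooth_on_add smooth_on_diff smooth_on_const smooth_on_sum
    smooth_on_component
  show q: "smooth_on V q" unfolding q_def[abs_def] by (intro ops d p)
  show E: "smooth_on V (E i j)" for i j unfolding E_def[abs_def] by (intro ops q dd)
  show f: "smooth_on V f" unfolding f_def[abs_def] by (intro ops smooth_on_sq_dist)
  show X: "smooth_on V (X j)" for j unfolding X_def[abs_def] by (intro ops d f v)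
  show "smooth_on V (F i)" unfolding F_def[abs_def] by (intro ops E X p)
qed

lemma diff: assumes "x \<in> V"
  shows "v differentiable (at x)" "d i differentiable (at x)" "dd i j differentiable (at x)"
    "q differentiable (at x)" "E i j differentiable (at x)" "f differentiable (at x)"
    "X j differentiable (at x)" "(\<lambda>x. v x powr a) differentiable (at x)"
    "(\<lambda>x. x $ j) differentiable (at x)"
  by (rule smooth_on_differentiable[OF _ assms], (rule v smooth smooth_on_component))+

lemma dd_commute: "x \<in> V \<Longrightarrow> dd i j x = dd j i x"
  by (rule partial_derivatives_commute[OF V(1) v])

lemma E_commute: "x \<in> V \<Longrightarrow> E i j x = E j i x"
  by (auto simp: E_def dd_commute)

lemma laplacian_eq: "x \<in> ball 0 1 \<Longrightarrow> (\<Sum>i\<in>UNIV. dd i i x) = real CARD('n) * q x"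
  using eq[of x] pos[of x] V(2) ball_subset_cball[of 0 1]
  by (simp add: laplacian_def q_def powr_minus field_simps power2_eq_square subset_eq)

lemma trace_E: "x \<in> ball 0 1 \<Longrightarrow> (\<Sum>i\<in>UNIV. E i i x) = 0"
  by (simp add: E_def sum_subtractf laplacian_eq)

text \<open>The derivative of \<open>|\<nabla>v|\<^sup>2\<close> supplies the Hessian, and that of \<open>1/v\<close> the trace part that turns the
  Hessian into \<open>E\<close>.\<close>
lemma grad_q:
  assumes "x \<in> V"
  shows "v x * partial_derivative j q x = (\<Sum>i\<in>UNIV. E j i x * d i x)"
proof -
  have S: "(\<lambda>x. \<Sum>i\<in>UNIV. d i x * d i x) differentiable (at x)"
    by (intro differentiable_sum differentiable_mult diff[OF assms] finite_class.finite_UNIV ballI)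
  have "partial_derivative j (\<lambda>x. \<Sum>i\<in>UNIV. d i x * d i x) x = (\<Sum>i\<in>UNIV. 2 * (dd j i x * d i x))"
    by (subst partial_derivative_sum)
      (auto simp: partial_derivative_mult diff[OF assms] intro!: sum.cong differentiable_mult)
  then have Sk: "partial_derivative j (\<lambda>x. (\<Sum>i\<in>UNIV. d i x * d i x) + k) x = 2 * (\<Sum>i\<in>UNIV. dd j i x * d i x)"
    by (simp add: partial_derivative_add[OF S differentiable_const] sum_distrib_left)
  have Z1: "(\<lambda>x. (\<Sum>i\<in>UNIV. d i x * d i x) + k) differentiable (at x)"
    by (rule differentiable_add[OF S differentiable_const])
  have Z2: "(\<lambda>x. ((\<Sum>i\<in>UNIV. d i x * d i x) + k) * v x powr (-1)) differentiable (at x)"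
    by (rule differentiable_mult[OF Z1 diff(8)[OF assms]])
  have "partial_derivative j q x = (1/2) * (((\<Sum>i\<in>UNIV. d i x * d i x) + k) *
     (- (v x powr (-2) * d j x)) + 2 * (\<Sum>i\<in>UNIV. dd j i x * d i x) * v x powr (-1))"
    unfolding q_def[abs_def] partial_derivative_mult[OF differentiable_const Z2]
      partial_derivative_mult[OF Z1 diff(8)[OF assms]] Sk
      partial_derivative_powr[OF diff(1)[OF assms] pos[OF assms]]
    by simp
  then have "v x * partial_derivative j q x = - q x * d j x + (\<Sum>i\<in>UNIV. dd j i x * d i x)"
    using pos[OF assms] by (simp add: q_def powr_minus field_simps powr_numeral power2_eq_square)
  also have "\<dots> = (\<Sum>i\<in>UNIV. E j i x * d i x)"
    by (simp add: E_def left_diff_distrib sum_subtractf if_distrib[of "\<lambda>z. z * _"] cong: if_cong)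
  finally show ?thesis .
qed

text \<open>Commuting derivatives turns the divergence of the Hessian into the gradient of the Laplacian.\<close>
lemma divergence_hessian:
  assumes "x \<in> ball 0 1"
  shows "(\<Sum>i\<in>UNIV. partial_derivative i (dd i j) x) = real CARD('n) * partial_derivative j q x"
proof -
  have xV: "x \<in> V" using assms V(2) by auto
  have "partial_derivative i (dd i j) x = partial_derivative j (dd i i) x" for i
  proof -
    have "partial_derivative i (dd i j) x = partial_derivative i (dd j i) x"
      by (rule partial_derivative_cong[OF V(1) xV dd_commute])
    also have "\<dots> = partial_derivative j (dd i i) x"
      by (rule partial_derivatives_commute[OF V(1) smooth(1) xV])
    finally show ?thesis .
  qed
  then have "(\<Sum>i\<in>UNIV. partial_derivative i (dd i j) x) = partial_derivative j (\<lambda>x. \<Sum>i\<in>UNIV. dd i i x) x"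
    by (simp add: partial_derivative_sum diff[OF xV])
  also have "\<dots> = partial_derivative j (\<lambda>x. real CARD('n) * q x) x"
    by (rule partial_derivative_cong[OF open_ball assms laplacian_eq])
  also have "\<dots> = real CARD('n) * partial_derivative j q x"
    by (simp add: partial_derivative_mult[OF differentiable_const diff(4)[OF xV]])
  finally show ?thesis .
qed

text \<open>With \<open>grad_q\<close> this says \<open>div E = (n - 1) E(\<nabla>v)/v\<close>, that is \<open>div(v\<^bsup>1-n\<^esup>E) = 0\<close>.\<close>
lemma divergence_E:
  assumes "x \<in> ball 0 1"
  shows "(\<Sum>i\<in>UNIV. partial_derivative i (E i j) x) = (real CARD('n) - 1) * partial_derivative j q x"
proof -
  have xV: "x \<in> V" using assms V(2) by auto
  have "partial_derivative i (E i j) x = partial_derivative i (dd i j) x - (if i = j then 1 else 0) * partial_derivative i q x" for i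
    unfolding E_def[abs_def]
    by (subst partial_derivative_diff)
      (auto simp: partial_derivative_mult[OF differentiable_const diff(4)[OF xV]]
        intro: diff[OF xV] differentiable_mult)
  then show ?thesis
    by (simp add: sum_subtractf divergence_hessian[OF assms] if_distrib[of "\<lambda>z. z * _"] left_diff_distrib
        cong: if_cong)
qed

lemma partial_f:
  assumes "x \<in> V"
  shows "partial_derivative i f x = kap * x $ i"
proof -
  have s: "sq_dist 0 differentiable (at x)"
    by (rule smooth_on_differentiable[OF smooth_on_sq_dist[OF open_UNIV]]) simp
  have ks: "(\<lambda>x. (kap / 2) * sq_dist 0 x) differentiable (at x)"
    by (intro differentiable_mult differentiable_const s)
  show ?thesis
    unfolding f_def[abs_def] partial_derivative_add[OF differentiable_const ks]
      partial_derivative_mult[OF differentiable_const s] partial_derivative_sq_dist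
    by simp
qed

lemma partial_X:
  assumes "x \<in> V"
  shows "partial_derivative i (X j) x = f x * dd i j x + kap * (x $ i * d j x - d i x * x $ j)
           + (h - kap * v x) * (if i = j then 1 else 0)"
proof -
  note D = diff[OF assms]
  have kv: "(\<lambda>x. kap * v x) differentiable (at x)"
    by (intro differentiable_mult differentiable_const D)
  have g: "(\<lambda>x. h - kap * v x) differentiable (at x)"
    by (intro differentiable_diff differentiable_const kv)
  show ?thesis
    unfolding X_def[abs_def] partial_derivative_add[OF differentiable_mult[OF D(6,2)] differentiable_mult[OF g D(9)]]
      partial_derivative_mult[OF D(6) D(2)] partial_derivative_mult[OF g D(9)]
      partial_derivative_diff[OF differentiable_const kv] partial_derivative_mult[OF differentiable_const D(1)]
      partial_f[OF assms] partial_derivative_component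
    by (simp add: algebra_simps)
qed

text \<open>Against the symmetric trace-free \<open>E\<close> only the term \<open>fE\<close> of the derivative of \<open>X\<close> survives.\<close>
lemma sum_E_partial_X:
  assumes "x \<in> ball 0 1"
  shows "(\<Sum>i\<in>UNIV. \<Sum>j\<in>UNIV. E i j x * partial_derivative i (X j) x) = f x * (\<Sum>i\<in>UNIV. \<Sum>j\<in>UNIV. (E i j x)\<^sup>2)"
proof -
  have xV: "x \<in> V" using assms V(2) by auto
  have dE: "dd i j x = E i j x + (if i = j then 1 else 0) * q x" for i j by (simp add: E_def)
  have "(\<Sum>i\<in>UNIV. \<Sum>j\<in>UNIV. E i j x * partial_derivative i (X j) x) =
     (\<Sum>i\<in>UNIV. \<Sum>j\<in>UNIV. f x * (E i j x)\<^sup>2 + kap * (E i j x * (x $ i * d j x)) - kap * (E i j x * (x $ j * d i x))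
       + (f x * q x + h - kap * v x) * (if i = j then E i j x else 0))"
    by (intro sum.cong refl) (simp add: partial_X[OF xV] dE algebra_simps power2_eq_square)
  also have "\<dots> = f x * (\<Sum>i\<in>UNIV. \<Sum>j\<in>UNIV. (E i j x)\<^sup>2)
      + kap * (\<Sum>i\<in>UNIV. \<Sum>j\<in>UNIV. E i j x * (x $ i * d j x))
      - kap * (\<Sum>i\<in>UNIV. \<Sum>j\<in>UNIV. E i j x * (x $ j * d i x))
      + (f x * q x + h - kap * v x) * (\<Sum>i\<in>UNIV. \<Sum>j\<in>UNIV. if i = j then E i j x else 0)"
    by (simp only: sum.distrib sum_subtractf sum_distrib_left)
  also have "(\<Sum>i\<in>UNIV. \<Sum>j\<in>UNIV. E i j x * (x $ j * d i x)) = (\<Sum>i\<in>UNIV. \<Sum>j\<in>UNIV. E i j x * (x $ i * d j x))"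
    by (subst sum.swap) (simp add: E_commute[OF xV])
  also have "(\<Sum>i\<in>UNIV. \<Sum>j\<in>UNIV. if i = j then E i j x else 0) = 0"
    using trace_E[OF assms] by simp
  finally show ?thesis by simp
qed

text \<open>The derivative of the power of \<open>v\<close> cancels the divergence of \<open>E\<close>; the exponent \<open>1 - n\<close> is chosen for
  this.\<close>
lemma divergence_F:
  assumes "x \<in> ball 0 1"
  shows "(\<Sum>i\<in>UNIV. partial_derivative i (F i) x) =
    v x powr (1 - real CARD('n)) * (f x * (\<Sum>i\<in>UNIV. \<Sum>j\<in>UNIV. (E i j x)\<^sup>2))"
proof -
  let ?N = "real CARD('n)"
  have xV: "x \<in> V" using assms V(2) by auto
  note D = diff[OF xV]
  have S: "(\<lambda>x. \<Sum>j\<in>UNIV. E i j x * X j x) differentiable (at x)" for i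
    by (intro differentiable_sum differentiable_mult D finite_class.finite_UNIV ballI)
  have "partial_derivative i (\<lambda>x. \<Sum>j\<in>UNIV. E i j x * X j x) x =
    (\<Sum>j\<in>UNIV. E i j x * partial_derivative i (X j) x + partial_derivative i (E i j) x * X j x)" for i
    by (subst partial_derivative_sum)
      (auto simp: partial_derivative_mult D intro!: sum.cong differentiable_mult)
  then have "partial_derivative i (F i) x =
     v x powr (1 - ?N) * (\<Sum>j\<in>UNIV. E i j x * partial_derivative i (X j) x + partial_derivative i (E i j) x * X j x)
     + (1 - ?N) * v x powr (1 - ?N - 1) * d i x * (\<Sum>j\<in>UNIV. E i j x * X j x)" for i
    unfolding F_def[abs_def]
    by (simp add: partial_derivative_mult[OF D(8) S] partial_derivative_powr[OF D(1) pos[OF xV]])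
  then have "(\<Sum>i\<in>UNIV. partial_derivative i (F i) x) =
     v x powr (1 - ?N) * (\<Sum>i\<in>UNIV. \<Sum>j\<in>UNIV. E i j x * partial_derivative i (X j) x)
     + v x powr (1 - ?N) * (\<Sum>i\<in>UNIV. \<Sum>j\<in>UNIV. partial_derivative i (E i j) x * X j x)
     + (1 - ?N) * v x powr (1 - ?N - 1) * (\<Sum>i\<in>UNIV. \<Sum>j\<in>UNIV. E i j x * d i x * X j x)"
    by (simp add: sum.distrib sum_distrib_left distrib_left mult_ac)
  also have "(\<Sum>i\<in>UNIV. \<Sum>j\<in>UNIV. partial_derivative i (E i j) x * X j x)
     = (?N - 1) * (\<Sum>j\<in>UNIV. partial_derivative j q x * X j x)"
    by (subst sum.swap) (simp add: sum_distrib_right[symmetric] divergence_E[OF assms] sum_distrib_left mult.assoc)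
  also have "(\<Sum>i\<in>UNIV. \<Sum>j\<in>UNIV. E i j x * d i x * X j x) = (\<Sum>j\<in>UNIV. (\<Sum>i\<in>UNIV. E j i x * d i x) * X j x)"
    by (subst sum.swap) (simp add: sum_distrib_right E_commute[OF xV])
  also have "\<dots> = v x * (\<Sum>j\<in>UNIV. partial_derivative j q x * X j x)"
    by (simp add: grad_q[OF xV, symmetric] sum_distrib_left mult.assoc)
  also have "v x powr (1 - ?N) = v x powr (1 - ?N - 1) * v x"
    using pos[OF xV] powr_add[of "v x" "1 - ?N - 1" 1] by simp
  finally show ?thesis
    using pos[OF xV] powr_add[of "v x" "1 - ?N - 1" 1]
    by (simp add: sum_E_partial_X[OF assms] algebra_simps)
qed

end

text \<open>Differentiate \<open>g\<close> along the great circle through \<open>x\<close> in the direction of \<open>w\<close>.\<close>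
lemma tangential_derivative_eq_0:
  fixes g :: "'a::euclidean_space \<Rightarrow> real"
  assumes "g differentiable (at x)" "norm x = 1" "x \<bullet> w = 0"
    and g0: "\<And>y. norm y = 1 \<Longrightarrow> g y = 0"
  shows "frechet_derivative g (at x) w = 0"
proof (cases "w = 0")
  case True
  then show ?thesis using linear_frechet_derivative[OF assms(1)] by (simp add: linear_0)
next
  case False
  define u where "u = w /\<^sub>R norm w"
  have u: "norm u = 1" "x \<bullet> u = 0" "w = norm w *\<^sub>R u"
    using False assms(3) by (auto simp: u_def)
  have unit: "norm (cos t *\<^sub>R x + sin t *\<^sub>R u) = 1" for t
  proof -
    have "(norm (cos t *\<^sub>R x + sin t *\<^sub>R u))\<^sup>2 = (cos t)\<^sup>2 * (norm x)\<^sup>2 + (sin t)\<^sup>2 * (norm u)\<^sup>2"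
      unfolding power2_norm_eq_inner using u(2)
      by (simp add: inner_add_left inner_add_right inner_commute power2_eq_square)
    then have "(norm (cos t *\<^sub>R x + sin t *\<^sub>R u))\<^sup>2 = 1\<^sup>2" using u assms(2) by simp
    then show ?thesis by (metis norm_ge_zero power2_eq_imp_eq zero_le_one)
  qed
  have c: "((\<lambda>t. cos t *\<^sub>R x + sin t *\<^sub>R u) has_derivative (\<lambda>t. t *\<^sub>R u)) (at 0)"
    by (auto intro!: derivative_eq_intros)
  have "(g has_derivative frechet_derivative g (at x)) (at (cos 0 *\<^sub>R x + sin 0 *\<^sub>R u))"
    using assms(1) by (simp add: frechet_derivative_works)
  from diff_chain_at[OF c this]
  have "((\<lambda>t. 0) has_derivative (\<lambda>t. frechet_derivative g (at x) (t *\<^sub>R u))) (at (0::real))"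
    by (simp add: o_def g0[OF unit])
  from has_derivative_unique[OF this has_derivative_const[of 0]]
  have "frechet_derivative g (at x) (norm w *\<^sub>R u) = 0" by metis
  then show ?thesis using u(3) by simp
qed

context conformal_factor
begin

text \<open>The function \<open>N = \<langle>x,\<nabla>v\<rangle> - \<kappa>v + h\<close> vanishes on the sphere by the boundary condition, so its derivative
  along the tangential field \<open>X\<close> vanishes too. This evaluates \<open>D\<^sup>2v(x,X)\<close>, and the trace part of \<open>E\<close>
  drops out because \<open>X\<close> is orthogonal to \<open>x\<close>.\<close>
lemma boundary_F:
  assumes "x \<in> sphere 0 1"
  shows "(\<Sum>i\<in>UNIV. x $ i * F i x) = v x powr (1 - real CARD('n)) * ((kap - 1) * (\<Sum>j\<in>UNIV. (X j x)\<^sup>2))"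
proof -
  have xV: "x \<in> V" using assms V(2) by auto
  note D = diff[OF xV]
  have nx: "norm x = 1" using assms by simp
  then have xx: "(\<Sum>i\<in>UNIV. x $ i * x $ i) = 1" by (simp add: norm_eq_1 inner_vec_def)
  have fx: "f x = 1" using nx by (simp add: f_def sq_dist_eq)
  have d_eq: "d j x = X j x + (kap * v x - h) * x $ j" for j
    by (simp add: X_def fx algebra_simps)
  have tang: "(\<Sum>j\<in>UNIV. x $ j * X j x) = 0"
  proof -
    have "(\<Sum>j\<in>UNIV. x $ j * ((kap * v x - h) * x $ j)) = (kap * v x - h) * (\<Sum>j\<in>UNIV. x $ j * x $ j)"
      unfolding sum_distrib_left by (intro sum.cong refl) simp
    then show ?thesis using bc[OF assms] by (simp add: d_eq distrib_left sum.distrib xx)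
  qed
  define N where "N y = (\<Sum>i\<in>UNIV. y $ i * d i y) + ((- kap) * v y + h)" for y
  have N1: "(\<lambda>y. \<Sum>i\<in>UNIV. y $ i * d i y) differentiable (at x)"
    by (intro differentiable_sum differentiable_mult D finite_class.finite_UNIV ballI)
  have N2: "(\<lambda>y. (- kap) * v y) differentiable (at x)"
    by (intro differentiable_mult differentiable_const D)
  have N3: "(\<lambda>y. (- kap) * v y + h) differentiable (at x)"
    by (intro differentiable_add differentiable_const N2)
  have Nd: "N differentiable (at x)" unfolding N_def[abs_def] by (rule differentiable_add[OF N1 N3])
  have "partial_derivative j (\<lambda>y. \<Sum>i\<in>UNIV. y $ i * d i y) x
      = (\<Sum>i\<in>UNIV. x $ i * dd j i x + (if j = i then 1 else 0) * d i x)" for j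
    by (subst partial_derivative_sum)
      (auto simp: partial_derivative_mult[OF D(9) D(2)] partial_derivative_component
        intro!: sum.cong differentiable_mult D)
  then have "partial_derivative j (\<lambda>y. \<Sum>i\<in>UNIV. y $ i * d i y) x = (\<Sum>i\<in>UNIV. x $ i * dd j i x) + d j x" for j
    by (simp add: sum.distrib if_distrib[of "\<lambda>z. z * _"] cong: if_cong)
  then have pN: "partial_derivative j N x = (\<Sum>i\<in>UNIV. x $ i * dd j i x) + (1 - kap) * d j x" for j
    unfolding N_def[abs_def] partial_derivative_add[OF N1 N3] partial_derivative_add[OF N2 differentiable_const]
      partial_derivative_mult[OF differentiable_const D(1)]
    by (simp add: algebra_simps)
  have "frechet_derivative N (at x) (\<chi> j. X j x) = 0"
  proof (rule tangential_derivative_eq_0[OF Nd nx])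
    show "x \<bullet> (\<chi> j. X j x) = 0" using tang by (simp add: inner_vec_def)
    show "N y = 0" if "norm y = 1" for y using bc[of y] that by (simp add: N_def)
  qed
  then have "(\<Sum>j\<in>UNIV. X j x * partial_derivative j N x) = 0"
    using frechet_derivative_eq_sum[OF Nd] by simp
  then have "(\<Sum>j\<in>UNIV. X j x * (\<Sum>i\<in>UNIV. x $ i * dd j i x)) = (kap - 1) * (\<Sum>j\<in>UNIV. X j x * d j x)"
    by (simp add: pN algebra_simps sum.distrib sum_subtractf sum_distrib_left)
  also have "(\<Sum>j\<in>UNIV. X j x * d j x) = (\<Sum>j\<in>UNIV. (X j x)\<^sup>2) + (kap * v x - h) * (\<Sum>j\<in>UNIV. x $ j * X j x)"
    by (simp add: d_eq distrib_left sum.distrib sum_distrib_left power2_eq_square mult_ac)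
  finally have main: "(\<Sum>j\<in>UNIV. X j x * (\<Sum>i\<in>UNIV. x $ i * dd j i x)) = (kap - 1) * (\<Sum>j\<in>UNIV. (X j x)\<^sup>2)"
    using tang by simp
  have "(\<Sum>i\<in>UNIV. x $ i * F i x) = v x powr (1 - real CARD('n)) * (\<Sum>i\<in>UNIV. \<Sum>j\<in>UNIV. x $ i * (E i j x * X j x))"
    by (simp add: F_def sum_distrib_left mult.left_commute)
  also have "(\<Sum>i\<in>UNIV. \<Sum>j\<in>UNIV. x $ i * (E i j x * X j x)) =
     (\<Sum>j\<in>UNIV. \<Sum>i\<in>UNIV. X j x * (x $ i * dd j i x) - (if i = j then q x * (x $ j * X j x) else 0))"
    by (subst sum.swap) (auto simp: E_def dd_commute[OF xV] algebra_simps intro!: sum.cong)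
  also have "\<dots> = (\<Sum>j\<in>UNIV. X j x * (\<Sum>i\<in>UNIV. x $ i * dd j i x)) - q x * (\<Sum>j\<in>UNIV. x $ j * X j x)"
    by (simp add: sum_subtractf sum_distrib_left)
  finally show ?thesis using main tang by simp
qed

lemma f_pos: "f x > 0"
  using kap by (auto simp: f_def sq_dist_eq intro!: add_pos_nonneg)

lemma E_eq_0:
  assumes "x \<in> ball 0 1"
  shows "E i j x = 0"
proof -
  have xV: "x \<in> V" if "x \<in> cball 0 1" for x using that V(2) by auto
  have "(\<Sum>i\<in>UNIV. partial_derivative i (F i) x) = 0"
  proof (rule divergence_eq_0[OF V smooth(7) _ _ assms])
    show "0 \<le> (\<Sum>i\<in>UNIV. partial_derivative i (F i) x)" if "x \<in> ball 0 1" for x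
      unfolding divergence_F[OF that] using f_pos[of x]
      by (intro mult_nonneg_nonneg sum_nonneg) auto
    show "(\<Sum>i\<in>UNIV. x $ i * F i x) \<le> 0" if "x \<in> sphere 0 1" for x
      unfolding boundary_F[OF that] using kap
      by (intro mult_nonneg_nonpos mult_nonpos_nonneg sum_nonneg) auto
  qed
  then have "(\<Sum>i\<in>UNIV. \<Sum>j\<in>UNIV. (E i j x)\<^sup>2) = 0"
    using divergence_F[OF assms] f_pos[of x] pos[OF xV[of x]] assms by auto
  then have "(\<Sum>j\<in>UNIV. (E i j x)\<^sup>2) = 0"
    by (subst (asm) sum_nonneg_eq_0_iff) (auto intro: sum_nonneg)
  then show ?thesis
    by (subst (asm) sum_nonneg_eq_0_iff) auto
qed

end

section \<open>The profile is a quadratic polynomial\<close>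

lemma constant_if_partial_derivatives_0:
  fixes g :: "real^'n \<Rightarrow> real"
  assumes "\<And>x. x \<in> ball 0 1 \<Longrightarrow> g differentiable (at x)"
    and "\<And>x i. x \<in> ball 0 1 \<Longrightarrow> partial_derivative i g x = 0"
    and "x \<in> ball 0 1"
  shows "g x = g 0"
proof -
  have "(g has_derivative (\<lambda>h. 0)) (at x within ball 0 1)" if "x \<in> ball 0 1" for x
    using has_derivative_partial[OF assms(1)[OF that]] assms(2)[OF that]
    by (simp add: has_derivative_at_withinI)
  then obtain c where "\<And>x. x \<in> ball 0 1 \<Longrightarrow> g x = c"
    using has_derivative_zero_constant[OF convex_ball[of "0::real^'n" 1]] by metis
  then show ?thesis using assms(3) by simp
qed

context conformal_factor
begin

lemma gradient_affine:
  assumes "x \<in> cball 0 1"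
  shows "d i x = q 0 * x $ i + d i 0"
proof -
  let ?B = "ball (0::real^'n) 1"
  have BV: "x \<in> V" if "x \<in> ?B" for x using that V(2) by auto
  have q_const: "q x = q 0" if "x \<in> ?B" for x
  proof (rule constant_if_partial_derivatives_0[OF _ _ that])
    show "partial_derivative j q x = 0" if "x \<in> ?B" for x j
      using grad_q[OF BV[OF that], of j] pos[OF BV[OF that]] E_eq_0[OF that] by simp
  qed (rule diff[OF BV])
  have D: "(\<lambda>x. q 0 * x $ i) differentiable (at x)" if "x \<in> ?B" for x
    by (intro differentiable_mult differentiable_const diff[OF BV[OF that]])
  have on_ball: "d i x - q 0 * x $ i = d i 0 - q 0 * 0 $ i" if "x \<in> ?B" for x
  proof (rule constant_if_partial_derivatives_0[OF _ _ that])
    show "(\<lambda>x. d i x - q 0 * x $ i) differentiable (at x)" if "x \<in> ?B" for x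
      by (intro differentiable_diff D diff[OF BV] that)
    show "partial_derivative j (\<lambda>x. d i x - q 0 * x $ i) x = 0" if "x \<in> ?B" for x j
      using E_eq_0[OF that, of j i] q_const[OF that]
      unfolding partial_derivative_diff[OF diff(2)[OF BV[OF that]] D[OF that]]
        partial_derivative_mult[OF differentiable_const diff(9)[OF BV[OF that]]]
        partial_derivative_component
      by (simp add: E_def)
  qed
  have cl: "closure ?B = cball 0 1" by (rule closure_ball) simp
  have "continuous_on (cball 0 1) (\<lambda>x. d i x - q 0 * x $ i)"
    using continuous_on_subset[OF smooth_on_continuous[OF smooth(1)] V(2)]
    by (intro continuous_intros)
  then have "d i x - q 0 * x $ i = d i 0 - q 0 * 0 $ i"
    using continuous_constant_on_closure[of ?B "\<lambda>x. d i x - q 0 * x $ i", OF _ on_ball] assms cl by metis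
  then show ?thesis by simp
qed

text \<open>The gradient of \<open>v\<close> is affine because \<open>E = 0\<close> and \<open>q\<close> is constant. The first identity between the
  coefficients is the definition of \<open>q\<close> at the centre; the other two separate the boundary condition into its
  even and odd parts under \<open>x \<mapsto> -x\<close>.\<close>
lemma quadratic:
  defines "b \<equiv> \<chi> i. d i 0"
  shows "x \<in> cball 0 1 \<Longrightarrow> v x = q 0 / 2 * (norm x)\<^sup>2 + x \<bullet> b + v 0"
    and "2 * q 0 * v 0 = (norm b)\<^sup>2 + k"
    and "q 0 = kap * (q 0 / 2 + v 0) - h"
    and "kap < 1 \<Longrightarrow> b = 0"
proof -
  let ?B = "ball (0::real^'n) 1"
  have BV: "x \<in> V" if "x \<in> ?B" for x using that V(2) by auto
  define l where "l x = (q 0 / 2) * sq_dist 0 x + (\<Sum>j\<in>UNIV. x $ j * d j 0)" for x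
  have l_eq: "l x = q 0 / 2 * (norm x)\<^sup>2 + x \<bullet> b" for x
    by (simp add: l_def b_def sq_dist_eq inner_vec_def)
  have s: "sq_dist 0 differentiable (at x)" for x :: "real^'n"
    by (rule smooth_on_differentiable[OF smooth_on_sq_dist[OF open_UNIV]]) simp
  have cj: "(\<lambda>x::real^'n. x $ j) differentiable (at x)" for j x
    by (rule smooth_on_differentiable[OF smooth_on_component[of UNIV]]) simp
  have l1: "(\<lambda>x. (q 0 / 2) * sq_dist 0 x) differentiable (at x)" for x :: "real^'n"
    by (intro differentiable_mult differentiable_const s)
  have l2: "(\<lambda>x. \<Sum>j\<in>UNIV. x $ j * d j 0) differentiable (at x)" for x
    by (intro differentiable_sum differentiable_mult differentiable_const cj finite_class.finite_UNIV ballI)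
  have l: "l differentiable (at x)" for x
    unfolding l_def[abs_def] by (rule differentiable_add[OF l1 l2])
  have "partial_derivative i (\<lambda>x. \<Sum>j\<in>UNIV. x $ j * d j 0) x = (\<Sum>j\<in>UNIV. (if i = j then 1 else 0) * d j 0)" for i x
    by (subst partial_derivative_sum)
      (auto simp: partial_derivative_mult[OF cj differentiable_const] partial_derivative_component
        intro!: differentiable_mult differentiable_const cj sum.cong)
  then have l2p: "partial_derivative i (\<lambda>x. \<Sum>j\<in>UNIV. x $ j * d j 0) x = d i 0" for i x
    by (simp add: if_distrib[of "\<lambda>z. z * _"] cong: if_cong)
  have lp: "partial_derivative i l x = q 0 * x $ i + d i 0" for i x
    unfolding l_def[abs_def] partial_derivative_add[OF l1 l2] l2p
      partial_derivative_mult[OF differentiable_const s] partial_derivative_sq_dist by simp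
  have on_ball: "v x - l x = v 0 - l 0" if "x \<in> ?B" for x
  proof (rule constant_if_partial_derivatives_0[OF _ _ that])
    show "(\<lambda>x. v x - l x) differentiable (at x)" if "x \<in> ?B" for x
      by (rule differentiable_diff[OF diff(1)[OF BV[OF that]] l])
    show "partial_derivative j (\<lambda>x. v x - l x) x = 0" if "x \<in> ?B" for x j
      unfolding partial_derivative_diff[OF diff(1)[OF BV[OF that]] l] lp
      using gradient_affine[of x j] that by simp
  qed
  have cl: "closure ?B = cball 0 1" by (rule closure_ball) simp
  have "continuous_on (cball 0 1) (\<lambda>x. v x - l x)"
    using continuous_on_subset[OF smooth_on_continuous[OF v] V(2)] l
    by (intro continuous_intros)
      (auto intro!: differentiable_imp_continuous_on simp: differentiable_on_def differentiable_at_withinI)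
  then have "v x - l x = v 0 - l 0" if "x \<in> cball 0 1" for x
    using continuous_constant_on_closure[of ?B "\<lambda>x. v x - l x", OF _ on_ball] that cl by metis
  then show vx: "v x = q 0 / 2 * (norm x)\<^sup>2 + x \<bullet> b + v 0" if "x \<in> cball 0 1" for x
    using that by (fastforce simp: l_eq)
  have "0 \<in> V" using V(2) by auto
  then have v0: "v 0 > 0" by (rule pos)
  have "(norm b)\<^sup>2 = (\<Sum>i\<in>UNIV. d i 0 * d i 0)"
    unfolding power2_norm_eq_inner by (simp add: b_def inner_vec_def)
  then show "2 * q 0 * v 0 = (norm b)\<^sup>2 + k"
    using v0 by (simp add: q_def powr_minus)
  have bd: "q 0 + x \<bullet> b = kap * (q 0 / 2 + x \<bullet> b + v 0) - h" if "norm x = 1" for x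
  proof -
    have "(\<Sum>i\<in>UNIV. x $ i * d i x) = (\<Sum>i\<in>UNIV. q 0 * (x $ i * x $ i) + x $ i * d i 0)"
      using gradient_affine[of x] that by (intro sum.cong refl) (simp add: algebra_simps)
    also have "\<dots> = q 0 * (x \<bullet> x) + x \<bullet> b"
      by (simp add: sum.distrib sum_distrib_left inner_vec_def b_def)
    also have "x \<bullet> x = 1" using that by (simp add: norm_eq_1)
    finally show ?thesis using bc[of x] vx[of x] that by simp
  qed
  \<comment> \<open>Compare the boundary condition at \<open>x\<close> and at \<open>-x\<close>.\<close>
  have bd2: "q 0 = kap * (q 0 / 2 + v 0) - h \<and> (1 - kap) * (x \<bullet> b) = 0" if "norm x = 1" for x
  proof -
    have "q 0 + x \<bullet> b = kap * (q 0 / 2 + v 0) - h + kap * (x \<bullet> b)"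
      "q 0 - x \<bullet> b = kap * (q 0 / 2 + v 0) - h - kap * (x \<bullet> b)"
      using bd[OF that] bd[of "- x"] that by (simp_all add: algebra_simps)
    then have "q 0 = kap * (q 0 / 2 + v 0) - h" "x \<bullet> b - kap * (x \<bullet> b) = 0" by linarith+
    then show ?thesis by (simp add: left_diff_distrib)
  qed
  have "norm (axis undefined 1 :: real^'n) = 1" by (simp add: norm_axis_1)
  then show "q 0 = kap * (q 0 / 2 + v 0) - h" using bd2 by blast
  show "b = 0" if "kap < 1"
  proof (rule ccontr)
    assume "b \<noteq> 0"
    then have "(1 - kap) * ((b /\<^sub>R norm b) \<bullet> b) = 0" by (intro bd2[THEN conjunct2]) simp
    then show False using that \<open>b \<noteq> 0\<close> by simp
  qed
qed

end

text \<open>The exponent \<open>s = -2/(n-2)\<close> satisfies \<open>s - 1 = ns/2\<close>, which makes the gradient terms of the two sides agree,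
  and with the critical exponent the two nonlinearities turn into the constants \<open>k\<close> and \<open>h\<close>.\<close>
lemma quadratic_profile:
  fixes g :: "real^'n \<Rightarrow> real" and R H lam :: real
  defines "N \<equiv> real CARD('n)"
  assumes U: "open U" "cball 0 1 \<subseteq> U" "smooth_on U g" and N: "N \<ge> 3"
    and gpos: "\<And>x. x \<in> cball 0 1 \<Longrightarrow> g x > 0"
    and lap: "\<And>x. x \<in> ball 0 1 \<Longrightarrow> - laplacian g x = (N - 2) / (4 * (N - 1)) * R * g x powr ((N + 2) / (N - 2))"
    and bd: "\<And>x. x \<in> sphere 0 1 \<Longrightarrow> (\<Sum>i\<in>UNIV. x $ i * partial_derivative i g x) + lam * g x
               = (N - 2) / (2 * (N - 1)) * H * g x powr (N / (N - 2))"
    and lam: "0 < lam" "lam \<le> (N - 2) / 2"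
  obtains \<alpha> b c where "c > 0" "2 * \<alpha> * c = (norm b)\<^sup>2 + R / (N * (N - 1))"
    "\<alpha> = 2 * lam / (N - 2) * (\<alpha> / 2 + c) - H / (N - 1)"
    "lam < (N - 2) / 2 \<Longrightarrow> b = 0"
    "\<And>x. x \<in> cball 0 1 \<Longrightarrow> g x = (\<alpha> / 2 * (norm x)\<^sup>2 + x \<bullet> b + c) powr (- ((N - 2) / 2))"
proof -
  define s where "s = - 2 / (N - 2)"
  define V where "V = {x \<in> U. g x > 0}"
  define v where "v x = g x powr s" for x
  let ?k = "R / (N * (N - 1))" and ?kap = "2 * lam / (N - 2)" and ?h = "H / (N - 1)"
  have s1: "s - 1 = - (N / (N - 2))" "s - 1 + (N + 2) / (N - 2) = - s" "(s - 1) + N / (N - 2) = 0"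
    "s - 1 + 1 = s" "s * (N - 2) = -2" "s - 1 = N / 2 * s"
  proof -
    obtain M where M: "N = M + 2" "M > 0" using N by (intro that[of "N - 2"]) auto
    show "s - 1 = - (N / (N - 2))" "s - 1 + (N + 2) / (N - 2) = - s" "(s - 1) + N / (N - 2) = 0"
      "s - 1 + 1 = s" "s * (N - 2) = -2" "s - 1 = N / 2 * s"
      unfolding s_def M(1) using M(2) by (simp_all add: field_simps)
  qed
  have V: "open V" "cball 0 1 \<subseteq> V"
  proof -
    have "open (U \<inter> g -` {0<..})"
      using U by (intro continuous_open_preimage smooth_on_continuous) auto
    then show "open V" by (simp add: V_def Int_def vimage_def)
    show "cball 0 1 \<subseteq> V" using U(2) gpos by (auto simp: V_def)
  qed
  have VU: "V \<subseteq> U" and gV: "\<And>x. x \<in> V \<Longrightarrow> g x > 0" by (auto simp: V_def)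
  have g: "smooth_on V g" using U(3) VU by (rule smooth_on_subset)
  have v: "smooth_on V v" unfolding v_def[abs_def] by (rule smooth_on_powr[OF V(1) g gV])
  have gd: "g differentiable (at x)" if "x \<in> V" for x using smooth_on_differentiable[OF g that] .
  have pv: "partial_derivative i v x = s * g x powr (s - 1) * partial_derivative i g x" if "x \<in> V" for i x
    unfolding v_def[abs_def] by (rule partial_derivative_powr[OF gd gV]) (rule that)+
  have lap_v: "laplacian v x = s * (s - 1) * g x powr (s - 2) * (\<Sum>i\<in>UNIV. (partial_derivative i g x)\<^sup>2)
     + s * g x powr (s - 1) * laplacian g x" if "x \<in> V" for x
  proof -
    have p: "(\<lambda>x. g x powr (s - 1)) differentiable (at x)"
      using smooth_on_differentiable[OF smooth_on_powr[OF V(1) g gV] that] .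
    have sp: "(\<lambda>x. s * g x powr (s - 1)) differentiable (at x)"
      by (intro differentiable_mult differentiable_const p)
    have gi: "partial_derivative i g differentiable (at x)" for i
      using smooth_on_differentiable[OF smooth_on_partial[OF g] that] .
    have "partial_derivative i (partial_derivative i v) x =
        partial_derivative i (\<lambda>x. s * g x powr (s - 1) * partial_derivative i g x) x" for i
      by (rule partial_derivative_cong[OF V(1) that pv])
    also have "\<dots> i = s * (s - 1) * g x powr (s - 2) * (partial_derivative i g x)\<^sup>2
        + s * g x powr (s - 1) * partial_derivative i (partial_derivative i g) x" for i
      unfolding partial_derivative_mult[OF sp gi] partial_derivative_mult[OF differentiable_const p]
        partial_derivative_powr[OF gd[OF that] gV[OF that]]
      by (simp add: power2_eq_square)
    finally show ?thesis by (simp add: laplacian_def sum.distrib sum_distrib_left)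
  qed
  interpret conformal_factor v V ?kap ?h ?k
  proof
    show "v x > 0" if "x \<in> V" for x using gV[OF that] by (simp add: v_def)
    show "laplacian v x = real CARD('n) * (((\<Sum>i\<in>UNIV. (partial_derivative i v x)\<^sup>2) + ?k) / (2 * v x))"
      if x: "x \<in> ball 0 1" for x
    proof -
      have xV: "x \<in> V" using x V(2) by auto
      have vpos: "v x > 0" using gV[OF xV] by (simp add: v_def)
      let ?S = "\<Sum>i\<in>UNIV. (partial_derivative i g x)\<^sup>2"
      have "(\<Sum>i\<in>UNIV. (partial_derivative i v x)\<^sup>2) = s\<^sup>2 * (g x powr (s - 1))\<^sup>2 * ?S"
        by (simp add: pv[OF xV] power_mult_distrib sum_distrib_left)
      also have "(g x powr (s - 1))\<^sup>2 = v x * g x powr (s - 2)"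
        unfolding v_def power2_eq_square powr_add[symmetric] by (rule arg_cong[where f = "(powr) (g x)"]) simp
      finally have T: "(\<Sum>i\<in>UNIV. (partial_derivative i v x)\<^sup>2) / v x = s * s * g x powr (s - 2) * ?S"
        using vpos by (simp add: power2_eq_square)
      have "real CARD('n) * (((\<Sum>i\<in>UNIV. (partial_derivative i v x)\<^sup>2) + ?k) / (2 * v x)) =
          N / 2 * ((\<Sum>i\<in>UNIV. (partial_derivative i v x)\<^sup>2) / v x) + N * ?k / 2 / v x"
        by (simp add: N_def add_divide_distrib distrib_left)
      also have "\<dots> = (N / 2 * s) * s * g x powr (s - 2) * ?S + R / (2 * (N - 1)) / v x"
        unfolding T using N by (simp add: mult_ac)
      finally have "real CARD('n) * (((\<Sum>i\<in>UNIV. (partial_derivative i v x)\<^sup>2) + ?k) / (2 * v x)) =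
          (N / 2 * s) * s * g x powr (s - 2) * ?S + R / (2 * (N - 1)) / v x" .
      moreover have "laplacian v x = (N / 2 * s) * s * g x powr (s - 2) * ?S + s * g x powr (s - 1) * laplacian g x"
        unfolding lap_v[OF xV] s1(6) by simp
      moreover have "s * g x powr (s - 1) * laplacian g x
          = - (s * (N - 2)) / (4 * (N - 1)) * R * (g x powr (s - 1) * g x powr ((N + 2) / (N - 2)))"
      proof -
        have "laplacian g x = - ((N - 2) / (4 * (N - 1)) * R * g x powr ((N + 2) / (N - 2)))"
          using lap[OF x] by linarith
        then show ?thesis by simp
      qed
      moreover have "g x powr (s - 1) * g x powr ((N + 2) / (N - 2)) = 1 / v x"
        unfolding powr_add[symmetric] s1(2) v_def by (simp add: powr_minus_divide)
      moreover have "- (- 2) / (4 * (N - 1)) * R * (1 / v x) = R / (2 * (N - 1)) / v x"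
        using N vpos by (simp add: field_simps)
      ultimately show ?thesis unfolding s1(5) by (simp only:)
    qed
    show "(\<Sum>i\<in>UNIV. x $ i * partial_derivative i v x) = ?kap * v x - ?h" if x: "x \<in> sphere 0 1" for x
    proof -
      have xV: "x \<in> V" using x V(2) by auto
      have "(\<Sum>i\<in>UNIV. x $ i * partial_derivative i v x)
          = s * g x powr (s - 1) * (\<Sum>i\<in>UNIV. x $ i * partial_derivative i g x)"
        by (simp add: pv[OF xV] sum_distrib_left mult_ac)
      also have "(\<Sum>i\<in>UNIV. x $ i * partial_derivative i g x) =
          (N - 2) / (2 * (N - 1)) * H * g x powr (N / (N - 2)) - lam * g x"
        using bd[OF x] by simp
      also have "s * g x powr (s - 1) * \<dots> = (s * (N - 2)) / (2 * (N - 1)) * H * (g x powr (s - 1) * g x powr (N / (N - 2)))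
           - s * lam * (g x powr (s - 1) * g x powr 1)"
        using gV[OF xV] by (simp add: algebra_simps)
      also have "\<dots> = - ?h - s * lam * v x"
        unfolding powr_add[symmetric] s1(3,4,5) v_def using gV[OF xV] N by (simp add: field_simps)
      finally show ?thesis by (simp add: s_def)
    qed
  qed (use V v lam N in \<open>auto simp: field_simps\<close>)
  show ?thesis
  proof (rule that)
    show "v 0 > 0" using subsetD[OF V(2), of 0] pos[of 0] by simp
    show "2 * q 0 * v 0 = (norm (\<chi> i. partial_derivative i v 0))\<^sup>2 + ?k" by (rule quadratic(2))
    show "q 0 = ?kap * (q 0 / 2 + v 0) - ?h" by (rule quadratic(3))
    show "(\<chi> i. partial_derivative i v 0) = 0" if "lam < (N - 2) / 2"
      using that N by (intro quadratic(4)) (simp add: field_simps)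
    show "g x = (q 0 / 2 * (norm x)\<^sup>2 + x \<bullet> (\<chi> i. partial_derivative i v 0) + v 0) powr (- ((N - 2) / 2))"
      if "x \<in> cball 0 1" for x
    proof -
      have "s * - ((N - 2) / 2) = 1" using s1(5) by simp
      then have "g x = v x powr (- ((N - 2) / 2))"
        using gpos[OF that] by (simp only: v_def powr_powr) simp
      then show ?thesis using quadratic(1)[OF that] by simp
    qed
  qed
qed

section \<open>Identification of the parameters\<close>

lemma scaled_powr:
  fixes k m Y :: real
  assumes "k > 0"
  shows "(sqrt k * Y) powr (- m) = (1 / k) powr (m / 2) * Y powr (- m)"
proof -
  have "sqrt k powr (- m) = (1 / k) powr (m / 2)"
    using assms by (simp add: powr_half_sqrt[symmetric] powr_powr powr_divide powr_minus_divide)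
  then show ?thesis by (simp add: powr_mult)
qed

text \<open>Here \<open>t = 1/\<kappa>\<close>. Eliminating \<open>\<alpha>\<close> leaves \<open>(2c - th)\<^sup>2 = t\<^sup>2h\<^sup>2 + k(2t - 1)\<close>, and \<open>c > 0\<close> selects the root
  \<open>c = eps sqrt k / 2\<close>.\<close>
lemma radial_parameters:
  fixes \<alpha> c k h t eps :: real
  assumes k: "k > 0" and c: "c > 0" and t: "t > 1" and h: "h \<ge> 0"
    and rel: "2 * \<alpha> * c = k" "t * \<alpha> = \<alpha> / 2 + c - t * h"
    and eps: "eps = sqrt (1 / k) * (t * h + sqrt (t\<^sup>2 * h\<^sup>2 + k * (2 * t - 1)))"
  shows "\<alpha> / 2 * y + c = sqrt k * (1 / (2 * eps) * y + eps / 2)"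
proof -
  have "c = t * h + (t - 1/2) * \<alpha>" using rel(2) by (simp add: algebra_simps)
  then have "4 * c * c = 4 * c * (t * h + (t - 1/2) * \<alpha>)" by (rule arg_cong)
  also have "\<dots> = 4 * c * (t * h) + (2 * t - 1) * (2 * \<alpha> * c)" by (simp add: algebra_simps)
  finally have "4 * c * c = 4 * c * (t * h) + (2 * t - 1) * (2 * \<alpha> * c)" .
  then have cc: "4 * c * c = 4 * c * (t * h) + (2 * t - 1) * k" using rel(1) by simp
  have "(2 * t - 1) * k > 0" using t k by simp
  then have "4 * c * (t * h) < 4 * c * c" using cc by linarith
  then have "t * h < c" using c by simp
  moreover have "(2 * c - t * h)\<^sup>2 = t\<^sup>2 * h\<^sup>2 + k * (2 * t - 1)"
    using cc by (simp add: power2_eq_square algebra_simps)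
  moreover have "t * h \<ge> 0" using t h by simp
  ultimately have "sqrt (t\<^sup>2 * h\<^sup>2 + k * (2 * t - 1)) = 2 * c - t * h"
    by (intro real_sqrt_unique) auto
  then have e: "eps = 2 * c / sqrt k" by (simp add: eps real_sqrt_divide)
  have "sqrt k * sqrt k = 2 * \<alpha> * c" using k rel(1) by simp
  then have "\<alpha> = sqrt k * sqrt k / (2 * c)" using c by simp
  then have "\<alpha> / 2 * y = sqrt k * (1 / (2 * eps) * y)" using c k by (simp add: e)
  then show ?thesis using c k by (simp add: e distrib_left)
qed

text \<open>With \<open>m = sqrt (h\<^sup>2 + k)\<close> and \<open>S = 2c - h\<close> the relations say \<open>S\<^sup>2 = |b|\<^sup>2 + m\<^sup>2\<close>, and the right centre is
  \<open>a = b/(S + m)\<close>: it satisfies \<open>|a|\<^sup>2 = (S - m)/(S + m)\<close>. Since \<open>eps sqrt k = m + h\<close> and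
  \<open>sqrt k / eps = m - h\<close>, all coefficients become rational in \<open>S\<close>, \<open>m\<close> and \<open>h\<close>.\<close>
lemma conformal_parameters:
  fixes b :: "'a::real_inner" and \<alpha> c k h eps :: real
  assumes k: "k > 0" and c: "c > 0"
    and rel: "2 * \<alpha> * c = (norm b)\<^sup>2 + k" "\<alpha> = \<alpha> / 2 + c - h"
    and eps: "eps = sqrt (1 / k) * (h + sqrt (h\<^sup>2 + k))"
  obtains a where "norm a < 1"
    "\<And>x. \<alpha> / 2 * (norm x)\<^sup>2 + x \<bullet> b + c = sqrt k *
      (((1 + eps\<^sup>2 * (norm a)\<^sup>2) * (norm x)\<^sup>2 + 2 * (1 + eps\<^sup>2) * (x \<bullet> a) + (eps\<^sup>2 + (norm a)\<^sup>2))
        / (2 * eps * (1 - (norm a)\<^sup>2)))"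
proof -
  define m where "m = sqrt (h\<^sup>2 + k)"
  define S where "S = 2 * c - h"
  have mm: "m\<^sup>2 = h\<^sup>2 + k" using k by (simp add: m_def)
  have m: "m > \<bar>h\<bar>" unfolding m_def using k by (intro real_less_rsqrt) auto
  have \<alpha>: "\<alpha> = 2 * (c - h)" using rel(2) by simp
  have SS: "S\<^sup>2 = (norm b)\<^sup>2 + m\<^sup>2"
    using rel(1) unfolding S_def mm \<alpha> by (simp add: power2_eq_square algebra_simps)
  have "S > 0"
  proof (rule ccontr)
    assume "\<not> S > 0"
    then have "0 \<le> - S" "- S < h" using c by (auto simp: S_def)
    then have "(- S)\<^sup>2 \<le> h\<^sup>2" by (intro power_mono) auto
    then show False using SS mm k zero_le_power2[of "norm b"] by simp
  qed
  have Sm: "S + m > 0" using \<open>S > 0\<close> m by linarith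
  define a where "a = b /\<^sub>R (S + m)"
  define A where "A = (S - m) / (S + m)"
  have "(norm a)\<^sup>2 = (norm b)\<^sup>2 / (S + m)\<^sup>2" using Sm by (simp add: a_def power_mult_distrib power_inverse divide_inverse mult.commute)
  also have "(norm b)\<^sup>2 = (S - m) * (S + m)" using SS by (simp add: power2_eq_square algebra_simps)
  finally have aA: "(norm a)\<^sup>2 = A" using Sm by (simp add: A_def power2_eq_square)
  have A1: "1 - A = 2 * m / (S + m)" using Sm by (simp add: A_def field_simps)
  have "(norm a)\<^sup>2 < 1\<^sup>2" using A1 Sm m unfolding aA
    by (smt (verit) divide_pos_pos one_power2)
  then have a: "norm a < 1" by (rule power_less_imp_less_base) simp
  let ?P = "sqrt k"
  have P: "?P > 0" "?P * ?P = k" using k by simp_all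
  have kk: "k = (m - h) * (m + h)" using mm by (simp add: power2_eq_square algebra_simps)
  have e: "eps = (m + h) / ?P" by (simp add: eps real_sqrt_divide m_def add.commute)
  have mh: "m + h > 0" using m by linarith
  have e2: "(m - h) * eps\<^sup>2 = m + h"
  proof -
    have "eps\<^sup>2 = (m + h) * (m + h) / k" using P by (simp add: e power2_eq_square)
    then have "(m - h) * eps\<^sup>2 = ((m - h) * (m + h)) * (m + h) / k" by simp
    then show ?thesis unfolding kk[symmetric] using k by simp
  qed
  have coef: "?P / (2 * eps * (1 - A)) = (m - h) * (S + m) / (4 * m)"
  proof -
    have "?P / (2 * eps * (1 - A)) = k * (S + m) / (4 * m * (m + h))"
      unfolding A1 e using P Sm m mh by (simp add: field_simps)
    then show ?thesis using mh unfolding kk by simp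
  qed
  show ?thesis
  proof (rule that[OF a])
    fix x :: 'a
    let ?X = "(norm x)\<^sup>2"
    have ab: "(S + m) * (x \<bullet> a) = x \<bullet> b" using Sm by (simp add: a_def)
    have SA: "(S + m) * A = S - m" using Sm by (simp add: A_def)
    have "?P * (((1 + eps\<^sup>2 * A) * ?X + 2 * (1 + eps\<^sup>2) * (x \<bullet> a) + (eps\<^sup>2 + A)) / (2 * eps * (1 - A)))
      = ?P / (2 * eps * (1 - A)) * ((1 + eps\<^sup>2 * A) * ?X + 2 * (1 + eps\<^sup>2) * (x \<bullet> a) + (eps\<^sup>2 + A))"
      by simp
    also have "\<dots> = (((m - h) * (S + m) + ((m - h) * eps\<^sup>2) * ((S + m) * A)) * ?X
         + 2 * ((m - h) + (m - h) * eps\<^sup>2) * ((S + m) * (x \<bullet> a))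
         + (((m - h) * eps\<^sup>2) * (S + m) + (m - h) * ((S + m) * A))) / (4 * m)"
      unfolding coef times_divide_eq_left
      by (rule arg_cong2[where f = "(/)"]) (simp_all add: algebra_simps)
    also have "\<dots> = (((m - h) * (S + m) + (m + h) * (S - m)) * ?X + 4 * m * (x \<bullet> b)
         + ((m + h) * (S + m) + (m - h) * (S - m))) / (4 * m)"
      unfolding e2 ab SA by simp
    also have "\<dots> = (4 * m * ((S - h) / 2 * ?X + x \<bullet> b + (S + h) / 2)) / (4 * m)"
      by (rule arg_cong2[where f = "(/)"]) (simp_all add: field_simps)
    also have "\<dots> = (S - h) / 2 * ?X + x \<bullet> b + (S + h) / 2" using m by simp
    also have "\<dots> = \<alpha> / 2 * ?X + x \<bullet> b + c" by (simp add: S_def \<alpha>)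
    finally show "\<alpha> / 2 * ?X + x \<bullet> b + c = ?P *
      (((1 + eps\<^sup>2 * (norm a)\<^sup>2) * ?X + 2 * (1 + eps\<^sup>2) * (x \<bullet> a) + (eps\<^sup>2 + (norm a)\<^sup>2))
        / (2 * eps * (1 - (norm a)\<^sup>2)))" unfolding aA by simp
  qed
qed

text \<open>A point \<open>x + tx\<close> lies in the closed ball for \<open>-2 \<le> t \<le> 0\<close>, where \<open>u\<close> and its extension \<open>g\<close> agree.\<close>
lemma normal_derivative_eq:
  fixes u g :: "real^'n \<Rightarrow> real"
  assumes "g differentiable (at x)" "norm x = 1" and ug: "\<And>y. y \<in> cball 0 1 \<Longrightarrow> u y = g y"
  shows "normal_derivative u x = frechet_derivative g (at x) x"
proof -
  have c: "((\<lambda>t. x + t *\<^sub>R x) has_derivative (\<lambda>t. t *\<^sub>R x)) (at 0)"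
    by (auto intro!: derivative_eq_intros)
  have "(g has_derivative frechet_derivative g (at x)) (at (x + 0 *\<^sub>R x))"
    using assms(1) by (simp add: frechet_derivative_works)
  from diff_chain_at[OF c this]
  have "((\<lambda>t. g (x + t *\<^sub>R x)) has_vector_derivative frechet_derivative g (at x) x) (at 0)"
    using linear_frechet_derivative[OF assms(1)]
    by (simp add: has_vector_derivative_def o_def linear_cmul)
  then have "((\<lambda>t. g (x + t *\<^sub>R x)) has_vector_derivative frechet_derivative g (at x) x) (at 0 within {..0})"
    by (rule has_vector_derivative_at_within)
  then have "((\<lambda>t. u (x + t *\<^sub>R x)) has_vector_derivative frechet_derivative g (at x) x) (at 0 within {..0})"
    unfolding has_vector_derivative_def
  proof (rule has_derivative_transform_within[where d = 2])
    fix t :: real assume t: "t \<in> {..0}" "dist t 0 < 2"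
    have "norm (x + t *\<^sub>R x) = \<bar>1 + t\<bar>"
      using assms(2) norm_scaleR[of "1 + t" x] by (simp add: scaleR_add_left)
    then show "g (x + t *\<^sub>R x) = u (x + t *\<^sub>R x)" using t by (intro ug[symmetric]) auto
  qed auto
  then have "((\<lambda>t. u (x + t *\<^sub>R x)) has_vector_derivative frechet_derivative g (at x) x) (at_left 0)"
    by (rule has_vector_derivative_within_subset) auto
  then show ?thesis
    unfolding normal_derivative_def by (intro vector_derivative_within) simp_all
qed

theorem theorem4:
  fixes u :: "real ^ 'n \<Rightarrow> real" and n :: nat and R H p lam :: real
  assumes "n = CARD('n)" and "n \<ge> 3"
    and "R > 0" and "H \<ge> 0"
    and "1 < p" and "p \<le> (real n + 2) / (real n - 2)"
    and "0 \<le> lam" and "lam \<le> 2 / (p - 1)"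
    and "smooth_up_to_boundary u"
    and "\<forall>x\<in>cball 0 1. 0 \<le> u x"
    and "\<forall>x\<in>ball 0 1. - laplacian u x = (real n - 2) / (4 * (real n - 1)) * R * u x powr p"
    and "\<forall>x\<in>sphere 0 1. normal_derivative u x + lam * u x
           = (real n - 2) / (2 * (real n - 1)) * H * u x powr ((p + 1) / 2)"
  shows
    "(lam = 0 \<longrightarrow> (\<forall>x\<in>cball 0 1. u x = 0)) \<and>
     (p = (real n + 2) / (real n - 2) \<and> 0 < lam \<and> lam < 2 / (p - 1) \<longrightarrow>
       (let eps = sqrt (real n * (real n - 1) / R) *
              ((real n - 2) / (2 * lam) * (H / (real n - 1)) +
               sqrt (((real n - 2) / (2 * lam))\<^sup>2 * (H / (real n - 1))\<^sup>2 +
                     R / (real n * (real n - 1)) * ((real n - 2) / lam - 1)))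
        in 0 < eps \<and>
           ((\<forall>x\<in>cball 0 1. u x = 0) \<or>
            (\<forall>x\<in>cball 0 1. u x =
               (real n * (real n - 1) / R) powr ((real n - 2) / 4) *
               (1 / (2 * eps) * (norm x)\<^sup>2 + eps / 2) powr (- ((real n - 2) / 2)))))) \<and>
     (p = (real n + 2) / (real n - 2) \<and> lam = 2 / (p - 1) \<longrightarrow>
       (let eps = sqrt (real n * (real n - 1) / R) *
              (H / (real n - 1) +
               sqrt ((H / (real n - 1))\<^sup>2 + R / (real n * (real n - 1))))
        in 0 < eps \<and>
           ((\<forall>x\<in>cball 0 1. u x = 0) \<or>
            (\<exists>a\<in>ball 0 1. \<forall>x\<in>cball 0 1. u x =
               (real n * (real n - 1) / R) powr ((real n - 2) / 4) *
               (((1 + eps\<^sup>2 * (norm a)\<^sup>2) * (norm x)\<^sup>2 + 2 * (1 + eps\<^sup>2) * (x \<bullet> a)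
                   + (eps\<^sup>2 + (norm a)\<^sup>2)) / (2 * eps * (1 - (norm a)\<^sup>2)))
                 powr (- ((real n - 2) / 2))))))"
proof -
  define N where "N = real n"
  have N: "N \<ge> 3" "N = real CARD('n)" using assms(1,2) by (simp_all add: N_def)
  obtain U g where U: "open U" "cball 0 1 \<subseteq> U" "smooth_on U g"
    and ug: "\<And>x. x \<in> cball 0 1 \<Longrightarrow> u x = g x"
    using assms(9) unfolding smooth_up_to_boundary_def by blast
  have gd: "g differentiable (at x)" if "x \<in> cball 0 1" for x
    using smooth_on_differentiable[OF U(3)] that U(2) by blast
  have ug': "u x = g x" if "x \<in> ball 0 1" for x using that by (intro ug) auto
  have gnonneg: "g x \<ge> 0" if "x \<in> cball 0 1" for x using bspec[OF assms(10) that] ug[OF that] by simp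
  have lap: "- laplacian g x = (N - 2) / (4 * (N - 1)) * R * g x powr p" if "x \<in> ball 0 1" for x
  proof -
    have "laplacian u x = laplacian g x" by (rule laplacian_cong[OF open_ball that ug'])
    then show ?thesis using bspec[OF assms(11) that] ug'[OF that] by (simp add: N_def)
  qed
  have bd: "frechet_derivative g (at x) x + lam * g x = (N - 2) / (2 * (N - 1)) * H * g x powr ((p + 1) / 2)"
    if "x \<in> sphere 0 1" for x
  proof -
    have "norm x = 1" "x \<in> cball 0 1" using that by auto
    then show ?thesis
      using bspec[OF assms(12) that] ug[of x] normal_derivative_eq[OF gd _ ug, of x] by (simp add: N_def)
  qed
  have lap_le: "laplacian g x \<le> 0" if "x \<in> ball 0 1" for x
  proof -
    have "0 \<le> - laplacian g x" unfolding lap[OF that] using N assms(3) by (intro mult_nonneg_nonneg) auto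
    then show ?thesis by simp
  qed
  have part1: "\<forall>x\<in>cball 0 1. u x = 0" if lam0: "lam = 0"
  proof -
    have "continuous_on (cball 0 1) g"
      using smooth_on_continuous[OF U(3)] U(2) continuous_on_subset by blast
    then obtain x0 where x0: "x0 \<in> cball 0 1" "\<And>x. x \<in> cball 0 1 \<Longrightarrow> g x0 \<le> g x"
      using continuous_attains_inf[of "cball 0 1" g] by auto
    have const: "g x = g x0" if "x \<in> cball 0 1" for x
    proof (rule strong_minimum_principle[OF U(1,3,2) lap_le x0(2) x0(1) refl _ that])
      assume s: "x0 \<in> sphere 0 1"
      have "frechet_derivative g (at x0) x0 = (N - 2) / (2 * (N - 1)) * H * g x0 powr ((p + 1) / 2)"
        using bd[OF s] lam0 by simp
      then show "0 \<le> frechet_derivative g (at x0) x0" using N assms(4) by simp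
    qed
    have "laplacian g 0 = laplacian (\<lambda>x::real^'n. g x0) 0"
      by (rule laplacian_cong[of "ball 0 1"]) (auto intro: const)
    then have "(N - 2) / (4 * (N - 1)) * R * g 0 powr p = 0" using lap[of 0] by simp
    then have "g 0 = 0" using N assms(3) by simp
    then have "g x0 = 0" using const[of 0] by simp
    then show ?thesis using ug const by auto
  qed
  have dichotomy: "(\<forall>x\<in>cball 0 1. u x = 0) \<or> (\<forall>x\<in>cball 0 1. g x > 0)"
  proof (cases "\<exists>x0\<in>cball 0 1. g x0 = 0")
    case True
    then obtain x0 where x0: "x0 \<in> cball 0 1" "g x0 = 0" by blast
    have "g x = 0" if "x \<in> cball 0 1" for x
      using strong_minimum_principle[OF U(1,3,2) lap_le gnonneg x0 _ that] bd[of x0] x0 by simp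
    then show ?thesis using ug by auto
  next
    case False
    then show ?thesis using gnonneg by (auto simp: order_less_le)
  qed
  define k where "k = R / (N * (N - 1))"
  define h where "h = H / (N - 1)"
  have k: "k > 0" "N * (N - 1) / R = 1 / k" using N assms(3) by (auto simp: k_def)
  have h: "h \<ge> 0" using N assms(4) by (simp add: h_def)
  have crit: "2 / (p - 1) = (N - 2) / 2" "(p + 1) / 2 = N / (N - 2)" if "p = (N + 2) / (N - 2)"
  proof -
    have "p - 1 = 4 / (N - 2)" "p + 1 = 2 * N / (N - 2)"
      unfolding that using N(1) by (simp_all add: divide_simps)
    then show "2 / (p - 1) = (N - 2) / 2" "(p + 1) / 2 = N / (N - 2)"
      using N(1) by (simp, simp add: divide_simps)
  qed
  have profile: "\<exists>\<alpha> b c. c > 0 \<and> 2 * \<alpha> * c = (norm b)\<^sup>2 + k \<and> \<alpha> = 2 * lam / (N - 2) * (\<alpha> / 2 + c) - h \<and>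
      (lam < (N - 2) / 2 \<longrightarrow> b = 0) \<and>
      (\<forall>x\<in>cball 0 1. u x = (\<alpha> / 2 * (norm x)\<^sup>2 + x \<bullet> b + c) powr (- ((N - 2) / 2)))"
    if pc: "p = (N + 2) / (N - 2)" and lam: "0 < lam" "lam \<le> (N - 2) / 2" and pos: "\<forall>x\<in>cball 0 1. g x > 0"
  proof -
    note crit = crit[OF pc]
    have bd': "(\<Sum>i\<in>UNIV. x $ i * partial_derivative i g x) + lam * g x
               = (N - 2) / (2 * (N - 1)) * H * g x powr (N / (N - 2))" if "x \<in> sphere 0 1" for x
      using bd[OF that] that frechet_derivative_eq_sum[OF gd, of x x] unfolding crit by simp
    show ?thesis
    proof (rule quadratic_profile[OF U, of R lam H, folded N(2)])
      fix \<alpha> c :: real and b :: "real^'n"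
      assume *: "c > 0" "2 * \<alpha> * c = (norm b)\<^sup>2 + R / (N * (N - 1))"
        "\<alpha> = 2 * lam / (N - 2) * (\<alpha> / 2 + c) - H / (N - 1)" "lam < (N - 2) / 2 \<Longrightarrow> b = 0"
        and gx: "\<And>x. x \<in> cball 0 1 \<Longrightarrow> g x = (\<alpha> / 2 * (norm x)\<^sup>2 + x \<bullet> b + c) powr (- ((N - 2) / 2))"
      have "\<forall>x\<in>cball 0 1. u x = (\<alpha> / 2 * (norm x)\<^sup>2 + x \<bullet> b + c) powr (- ((N - 2) / 2))"
        using ug gx by metis
      with * show ?thesis unfolding k_def h_def by blast
    qed (use N(1) pos lap[unfolded pc] bd' lam in auto)
  qed
  have part2: "0 < eps \<and> ((\<forall>x\<in>cball 0 1. u x = 0) \<or> (\<forall>x\<in>cball 0 1. u x =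
      (1 / k) powr ((N - 2) / 4) * (1 / (2 * eps) * (norm x)\<^sup>2 + eps / 2) powr (- ((N - 2) / 2))))"
    if pc: "p = (N + 2) / (N - 2)" and lam: "0 < lam" "lam < (N - 2) / 2"
      and eps: "eps = sqrt (1 / k) * ((N - 2) / (2 * lam) * h +
           sqrt (((N - 2) / (2 * lam))\<^sup>2 * h\<^sup>2 + k * ((N - 2) / lam - 1)))" for eps
  proof -
    define t where "t = (N - 2) / (2 * lam)"
    have t: "t > 1" using lam by (simp add: t_def)
    have t2: "(N - 2) / lam = 2 * t" "2 * lam / (N - 2) = 1 / t" using lam N(1) by (simp_all add: t_def field_simps)
    have eps_t: "eps = sqrt (1 / k) * (t * h + sqrt (t\<^sup>2 * h\<^sup>2 + k * (2 * t - 1)))"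
      unfolding eps t2 t_def[symmetric] ..
    have "t * h \<ge> 0" "sqrt (t\<^sup>2 * h\<^sup>2 + k * (2 * t - 1)) > 0"
      using t h k by (auto intro!: add_nonneg_pos)
    then have epos: "eps > 0" unfolding eps_t using k by (intro mult_pos_pos add_nonneg_pos) auto
    have "\<forall>x\<in>cball 0 1. u x =
      (1 / k) powr ((N - 2) / 4) * (1 / (2 * eps) * (norm x)\<^sup>2 + eps / 2) powr (- ((N - 2) / 2))"
      if gpos: "\<forall>x\<in>cball 0 1. g x > 0"
    proof -
      obtain \<alpha> b c where P: "c > 0" "2 * \<alpha> * c = (norm b)\<^sup>2 + k" "\<alpha> = 1 / t * (\<alpha> / 2 + c) - h" "b = 0"
        "\<And>x. x \<in> cball 0 1 \<Longrightarrow> u x = (\<alpha> / 2 * (norm x)\<^sup>2 + x \<bullet> b + c) powr (- ((N - 2) / 2))"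
        using profile[OF pc lam(1) less_imp_le[OF lam(2)] gpos] lam(2) unfolding t2 by blast
      have "t * \<alpha> = t * (1 / t * (\<alpha> / 2 + c) - h)" using P(3) by simp
      also have "\<dots> = \<alpha> / 2 + c - t * h" using t by (simp add: right_diff_distrib)
      finally have rel: "t * \<alpha> = \<alpha> / 2 + c - t * h" .
      show ?thesis
      proof
        fix x :: "real^'n" assume x: "x \<in> cball 0 1"
        have "u x = (sqrt k * (1 / (2 * eps) * (norm x)\<^sup>2 + eps / 2)) powr (- ((N - 2) / 2))"
          using P radial_parameters[OF k(1) P(1) t h _ rel eps_t, of "(norm x)\<^sup>2"] x by simp
        also have "\<dots> = (1 / k) powr ((N - 2) / 2 / 2) * (1 / (2 * eps) * (norm x)\<^sup>2 + eps / 2) powr (- ((N - 2) / 2))"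
          by (rule scaled_powr[OF k(1)])
        finally show "u x = (1 / k) powr ((N - 2) / 4) * (1 / (2 * eps) * (norm x)\<^sup>2 + eps / 2) powr (- ((N - 2) / 2))"
          by simp
      qed
    qed
    then show ?thesis using dichotomy epos by blast
  qed
  have part3: "0 < eps \<and> ((\<forall>x\<in>cball 0 1. u x = 0) \<or> (\<exists>a\<in>ball 0 1. \<forall>x\<in>cball 0 1. u x =
      (1 / k) powr ((N - 2) / 4) * (((1 + eps\<^sup>2 * (norm a)\<^sup>2) * (norm x)\<^sup>2 + 2 * (1 + eps\<^sup>2) * (x \<bullet> a)
         + (eps\<^sup>2 + (norm a)\<^sup>2)) / (2 * eps * (1 - (norm a)\<^sup>2))) powr (- ((N - 2) / 2))))"
    if pc: "p = (N + 2) / (N - 2)" and lam: "lam = (N - 2) / 2"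
      and eps: "eps = sqrt (1 / k) * (h + sqrt (h\<^sup>2 + k))" for eps
  proof -
    have "sqrt (h\<^sup>2 + k) > 0" using k by (simp add: add_nonneg_pos)
    then have epos: "eps > 0" unfolding eps using k h by (intro mult_pos_pos add_nonneg_pos) auto
    have "\<exists>a\<in>ball 0 1. \<forall>x\<in>cball 0 1. u x =
      (1 / k) powr ((N - 2) / 4) * (((1 + eps\<^sup>2 * (norm a)\<^sup>2) * (norm x)\<^sup>2 + 2 * (1 + eps\<^sup>2) * (x \<bullet> a)
         + (eps\<^sup>2 + (norm a)\<^sup>2)) / (2 * eps * (1 - (norm a)\<^sup>2))) powr (- ((N - 2) / 2))"
      if gpos: "\<forall>x\<in>cball 0 1. g x > 0"
    proof -
      have lam': "0 < lam" "lam \<le> (N - 2) / 2" "2 * lam / (N - 2) = 1" using lam N by auto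
      obtain \<alpha> b c where P: "c > 0" "2 * \<alpha> * c = (norm b)\<^sup>2 + k" "\<alpha> = \<alpha> / 2 + c - h"
        "\<And>x. x \<in> cball 0 1 \<Longrightarrow> u x = (\<alpha> / 2 * (norm x)\<^sup>2 + x \<bullet> b + c) powr (- ((N - 2) / 2))"
        using profile[OF pc lam'(1,2) gpos] unfolding lam'(3) mult_1 by blast
      obtain a where a: "norm a < 1"
        "\<And>x. \<alpha> / 2 * (norm x)\<^sup>2 + x \<bullet> b + c = sqrt k *
          (((1 + eps\<^sup>2 * (norm a)\<^sup>2) * (norm x)\<^sup>2 + 2 * (1 + eps\<^sup>2) * (x \<bullet> a) + (eps\<^sup>2 + (norm a)\<^sup>2))
            / (2 * eps * (1 - (norm a)\<^sup>2)))"
        using conformal_parameters[OF k(1) P(1,2,3) eps] by metis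
      show ?thesis
      proof (intro bexI[of _ a] ballI)
        fix x :: "real^'n" assume x: "x \<in> cball 0 1"
        let ?Y = "((1 + eps\<^sup>2 * (norm a)\<^sup>2) * (norm x)\<^sup>2 + 2 * (1 + eps\<^sup>2) * (x \<bullet> a) + (eps\<^sup>2 + (norm a)\<^sup>2))
            / (2 * eps * (1 - (norm a)\<^sup>2))"
        have ux: "u x = (sqrt k * ?Y) powr (- ((N - 2) / 2))" using P(4)[OF x] a(2) by simp
        have "u x = (1 / k) powr ((N - 2) / 2 / 2) * ?Y powr (- ((N - 2) / 2))"
          unfolding ux by (rule scaled_powr[OF k(1)])
        then show "u x = (1 / k) powr ((N - 2) / 4) * ?Y powr (- ((N - 2) / 2))" by simp
      qed (use a in auto)
    qed
    then show ?thesis using dichotomy epos by blast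
  qed
  show ?thesis
    unfolding N_def[symmetric] Let_def h_def[symmetric] k_def[symmetric] k(2)
    using part1 part2 part3 crit by auto
qed

end
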